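(* Let $F:\mathbb{R}^d\to\mathbb{R}$ be differentiable and satisfy the smoothness assumption (S), the coercivity assumption (C), the local strong convexity assumption (SC), and, for a fixed temperature $\gamma>0$, the log-Sobolev assumption (LSI) with constant $\beta>0$. Let $(X_n,Y_n)_{n\ge0}$ be the iterates of either GDxLD or nGDxLD with deterministic initial points $X_0,Y_0$, temperature $\gamma$, step size $h$ and threshold $t_0\in[0,r_0/8)$; in the case of GDxLD assume in addition $t_0>0$. Fix $h\in(0,1)$ with $$h<\left(\frac{\pi_\gamma(B_0)}{2R_V+6\sqrt d\,L/\sqrt{\beta\gamma}}\right)^2,\qquad R_V=\frac{8(M_c/4+4\gamma Ld)}{\lambda_c}.$$ For $\epsilon>0$ and $\delta>0$ set $$K=\frac{\log\delta}{\log(1-\pi_\gamma(B_0)/2)},\qquad n_0=\frac{1}{\beta\gamma}\,\frac1h\log\frac1h .$$ Then there exists $$N(\beta,\epsilon,\delta)=O(Kn_0)+O(\log(1/\epsilon))=O(\log(1/\delta)/\beta)+O(\log(1/\epsilon))$$ such that for all $n\ge N(\beta,\epsilon,\delta)$, $$\mathbb{P}(\|X_n-x^*\|\le\epsilon)>1-\delta .$$ Here the $O(\cdot)$ bounds are for small $\epsilon,\delta$ (say $\epsilon,\delta\in(0,1/2)$), with implicit constants that do not depend on $\epsilon,\delta,\beta$ (they may depend on $F,d,\gamma,h,t_0,X_0,Y_0$).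
   Context: Algorithms GDxLD and nGDxLD. Given $X_0,Y_0$, temperature $\gamma>0$, step size $h>0$, threshold $t_0\ge0$, and i.i.d. $Z_0,Z_1,\dots\sim\mathcal N(0,I_d)$, for $n\ge0$ set $$X'_{n+1}=X_n-h\nabla F(X_n),\qquad Y'_{n+1}=Y_n-h\nabla F(Y_n)+\sqrt{2\gamma h}\,Z_n .$$ If $F(Y'_{n+1})<F(X'_{n+1})-t_0$, then set $(X_{n+1},Y_{n+1})=(Y'_{n+1},X'_{n+1})$ for GDxLD, and $(X_{n+1},Y_{n+1})=(Y'_{n+1},Y'_{n+1})$ for nGDxLD. Otherwise set $(X_{n+1},Y_{n+1})=(X'_{n+1},Y'_{n+1})$. Assumptions. (S) There is $L\in(0,\infty)$ with $\|\nabla F(x)-\nabla F(y)\|\le L\|x-y\|$ for all $x,y\in\mathbb{R}^d$. (C) There are $\lambda_c,M_c\in(0,\infty)$ with $\|\nabla F(x)\|^2\ge\lambda_cF(x)-M_c$ for all $x$, and $F(x)\to\infty$ as $\|x\|\to\infty$. (SC) $x^*$ is the unique global minimum of $F$. There is $r_0>0$ such that the sub-level set $B_0=\{x:F(x)\le F(x^* )+r_0\}$ is star-convex with center $x^*$. There are $m,M,r>0$ such that $B_0\subset\{x:\|x-x^*\|<r\}$, the Hessian $\nabla^2F(x)$ exists for all $\|x-x^*\|<r$, and $m\|v\|^2\le v^T\nabla^2F(x)v\le M\|v\|^2$ for all vectors $v$ and all $x$ with $\|x-x^*\|<r$. (LSI) Let $\pi_\gamma$ be the probability measure with density proportional to $\exp(-F(x)/\gamma)$.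 It satisfies the log-Sobolev inequality with constant $\beta>0$: for all smooth $f$ (for which the terms are finite), $$\int f^2\log f^2\,d\pi_\gamma-\Big(\int f^2d\pi_\gamma\Big)\log\Big(\int f^2d\pi_\gamma\Big)\le\frac2\beta\int\|\nabla f\|^2d\pi_\gamma .$$ *)

theory Defs
  imports "HOL-Probability.Probability"
begin

definition grad :: "('a::real_inner \<Rightarrow> real) \<Rightarrow> 'a \<Rightarrow> 'a" where
  "grad f x = (THE D. GDERIV f x :> D)"

lemma grad_eqI:
  assumes "GDERIV f x :> D"
  shows "grad f x = D"
  unfolding grad_def
proof (rule the_equality[where P = "\<lambda>D. GDERIV f x :> D", OF assms])
  fix D' assume "GDERIV f x :> D'"
  then have "(\<lambda>h. h \<bullet> D') = (\<lambda>h. h \<bullet> D)"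
    using assms unfolding gderiv_def by (rule has_derivative_unique)
  then show "D' = D"
    by (metis inner_commute vector_eq_ldot)
qed

lemma GDERIV_grad:
  fixes f :: "'a::euclidean_space \<Rightarrow> real"
  assumes "f differentiable (at x)"
  shows "GDERIV f x :> grad f x"
proof -
  from assms obtain f' where f': "(f has_derivative f') (at x)"
    unfolding differentiable_def by blast
  then interpret bounded_linear f' by (rule has_derivative_bounded_linear)
  have "f' = (\<lambda>h. h \<bullet> adjoint f' 1)"
    using adjoint_works[OF linear_axioms, of _ 1] by (auto simp: fun_eq_iff)
  then have "GDERIV f x :> adjoint f' 1"
    using f' unfolding gderiv_def by simp
  then show ?thesis using grad_eqI by metis
qed

text \<open>Here \<open>C_k k f\<close> says that \<open>f\<close> is \<open>k\<close> times continuously differentiable; the higher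
  derivatives are taken as iterated directional derivatives.\<close>

primrec C_k :: "nat \<Rightarrow> ('a::real_normed_vector \<Rightarrow> real) \<Rightarrow> bool" where
  "C_k 0 f \<longleftrightarrow> continuous_on UNIV f"
| "C_k (Suc k) f \<longleftrightarrow> f differentiable_on UNIV \<and>
     (\<forall>v. C_k k (\<lambda>x. frechet_derivative f (at x) v))"

definition smooth :: "('a::real_normed_vector \<Rightarrow> real) \<Rightarrow> bool" where
  "smooth f \<longleftrightarrow> (\<forall>k. C_k k f)"

definition smooth_gradient :: "('a::euclidean_space \<Rightarrow> real) \<Rightarrow> real \<Rightarrow> bool" where
  "smooth_gradient F L \<longleftrightarrow> 0 < L \<and> (\<forall>x y. norm (grad F x - grad F y) \<le> L * norm (x - y))"

definition coercive :: "('a::euclidean_space \<Rightarrow> real) \<Rightarrow> real \<Rightarrow> real \<Rightarrow> bool" where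
  "coercive F lam_c M_c \<longleftrightarrow> 0 < lam_c \<and> 0 < M_c \<and>
     (\<forall>x. (norm (grad F x))\<^sup>2 \<ge> lam_c * F x - M_c) \<and>
     filterlim F at_top at_infinity"

definition sublevel :: "('a \<Rightarrow> real) \<Rightarrow> 'a \<Rightarrow> real \<Rightarrow> 'a set" where
  "sublevel F xs r0 = {x. F x \<le> F xs + r0}"

definition star_convex :: "'a::real_vector \<Rightarrow> 'a set \<Rightarrow> bool" where
  "star_convex c S \<longleftrightarrow> (\<forall>x\<in>S. closed_segment c x \<subseteq> S)"

text \<open>The Hessian at \<open>x\<close> is the derivative \<open>H\<close> of the gradient, so that \<open>v \<bullet> H v\<close> is its
  quadratic form.\<close>

definition locally_strongly_convex ::
  "('a::euclidean_space \<Rightarrow> real) \<Rightarrow> 'a \<Rightarrow> real \<Rightarrow> bool" where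
  "locally_strongly_convex F xs r0 \<longleftrightarrow>
     (\<forall>x. x \<noteq> xs \<longrightarrow> F xs < F x) \<and>
     0 < r0 \<and> star_convex xs (sublevel F xs r0) \<and>
     (\<exists>m M r. 0 < m \<and> 0 < M \<and> 0 < r \<and>
        sublevel F xs r0 \<subseteq> {x. norm (x - xs) < r} \<and>
        (\<forall>x. norm (x - xs) < r \<longrightarrow>
          (\<exists>H. (grad F has_derivative H) (at x) \<and>
               (\<forall>v. m * (norm v)\<^sup>2 \<le> v \<bullet> H v \<and> v \<bullet> H v \<le> M * (norm v)\<^sup>2))))"

text \<open>If \<open>exp (- F / \<gamma>)\<close> is not Lebesgue integrable, the normalising constant is \<open>0\<close> in HOL
  and \<open>gibbs F \<gamma>\<close> is the zero measure; otherwise it is a probability measure.\<close>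

definition gibbs :: "('a::euclidean_space \<Rightarrow> real) \<Rightarrow> real \<Rightarrow> 'a measure" where
  "gibbs F \<gamma> = density lborel
     (\<lambda>x. ennreal (exp (- F x / \<gamma>) / (\<integral>y. exp (- F y / \<gamma>) \<partial>lborel)))"

text \<open>Since \<open>ln 0 = 0\<close>, the usual convention \<open>0 log 0 = 0\<close> holds.\<close>

definition log_sobolev :: "'a::euclidean_space measure \<Rightarrow> real \<Rightarrow> bool" where
  "log_sobolev \<pi> \<beta> \<longleftrightarrow>
     (\<forall>f. smooth f \<and> integrable \<pi> (\<lambda>x. (f x)\<^sup>2) \<and>
          integrable \<pi> (\<lambda>x. (f x)\<^sup>2 * ln ((f x)\<^sup>2)) \<and>
          integrable \<pi> (\<lambda>x. (norm (grad f x))\<^sup>2) \<longrightarrow>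
        (\<integral>x. (f x)\<^sup>2 * ln ((f x)\<^sup>2) \<partial>\<pi>) - (\<integral>x. (f x)\<^sup>2 \<partial>\<pi>) * ln (\<integral>x. (f x)\<^sup>2 \<partial>\<pi>)
          \<le> 2 / \<beta> * (\<integral>x. (norm (grad f x))\<^sup>2 \<partial>\<pi>))"

definition std_gaussian_density :: "'a::euclidean_space \<Rightarrow> real" where
  "std_gaussian_density z = (2 * pi) powr (- real DIM('a) / 2) * exp (- (norm z)\<^sup>2 / 2)"

definition iid_std_gaussian ::
  "'w measure \<Rightarrow> (nat \<Rightarrow> 'w \<Rightarrow> 'a::euclidean_space) \<Rightarrow> bool" where
  "iid_std_gaussian P Z \<longleftrightarrow> prob_space.indep_vars P (\<lambda>_. borel) Z UNIV \<and>
     (\<forall>n. distributed P lborel (Z n) (\<lambda>z. ennreal (std_gaussian_density z)))"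

datatype variant = GDxLD | nGDxLD

definition ld_step ::
  "variant \<Rightarrow> ('a::euclidean_space \<Rightarrow> real) \<Rightarrow> real \<Rightarrow> real \<Rightarrow> real \<Rightarrow> 'a \<Rightarrow> 'a \<times> 'a \<Rightarrow> 'a \<times> 'a" where
  "ld_step alg F \<gamma> h t0 z = (\<lambda>(x, y).
     let x' = x - h *\<^sub>R grad F x;
         y' = y - h *\<^sub>R grad F y + sqrt (2 * \<gamma> * h) *\<^sub>R z
     in if F y' < F x' - t0
        then (case alg of GDxLD \<Rightarrow> (y', x') | nGDxLD \<Rightarrow> (y', y'))
        else (x', y'))"

primrec iterates ::
  "variant \<Rightarrow> ('a::euclidean_space \<Rightarrow> real) \<Rightarrow> real \<Rightarrow> real \<Rightarrow> real \<Rightarrow> 'a \<Rightarrow> 'a \<Rightarrow>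
     (nat \<Rightarrow> 'a) \<Rightarrow> nat \<Rightarrow> 'a \<times> 'a" where
  "iterates alg F \<gamma> h t0 x0 y0 z 0 = (x0, y0)"
| "iterates alg F \<gamma> h t0 x0 y0 z (Suc n) =
     ld_step alg F \<gamma> h t0 (z n) (iterates alg F \<gamma> h t0 x0 y0 z n)"

definition R_V :: "real \<Rightarrow> nat \<Rightarrow> real \<Rightarrow> real \<Rightarrow> real \<Rightarrow> real" where
  "R_V \<gamma> d L lam_c M_c = 8 * (M_c / 4 + 4 * \<gamma> * L * real d) / lam_c"

text \<open>The arguments \<open>p\<close> below stand for the mass \<open>\<pi>\<^sub>\<gamma>(B\<^sub>0)\<close>.\<close>

definition step_bound :: "real \<Rightarrow> real \<Rightarrow> real \<Rightarrow> nat \<Rightarrow> real \<Rightarrow> real \<Rightarrow> real \<Rightarrow> real" where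
  "step_bound p \<beta> \<gamma> d L lam_c M_c =
     (p / (2 * R_V \<gamma> d L lam_c M_c + 6 * sqrt (real d) * L / sqrt (\<beta> * \<gamma>)))\<^sup>2"

definition K_blocks :: "real \<Rightarrow> real \<Rightarrow> real" where
  "K_blocks p \<delta> = ln \<delta> / ln (1 - p / 2)"

definition n_block :: "real \<Rightarrow> real \<Rightarrow> real \<Rightarrow> real" where
  "n_block \<beta> \<gamma> h = 1 / (\<beta> * \<gamma>) * (1 / h) * ln (1 / h)"

end

theory Submission
  imports Defs
begin

text \<open>Once the first component \<open>X\<close> is in the sub-level set \<open>B\<^sub>0\<close> of \<open>xstar\<close>, the proof is deterministic. No step makes
  \<open>F X\<close> larger than a gradient step would, and on \<open>B\<^sub>0\<close> local strong convexity makes the gradient steps contract the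
  gap \<open>F X - F xstar\<close> geometrically (\<open>obtain_convergence_after_entry\<close>). This accounts for the
  \<open>log (1/\<epsilon>)\<close> term.

  It remains to show that \<open>X\<close> stays outside \<open>B\<^sub>0\<close> for \<open>n\<close> steps only with geometrically small probability
  (\<open>obtain_geometric_escape\<close>). As long as \<open>X\<close> is outside, a visit of the noisy point to a neighbourhood of
  \<open>xstar\<close> makes the algorithm move \<open>X\<close> there. The noisy component \<open>Y\<close> is held back by a drift: coercivity
  makes the mean of \<open>F Y - F xstar\<close> decrease by a constant factor, up to an additive constant, and an
  exchange leaves \<open>Y\<close> at the noisy point or replaces it by a point of value at most \<open>F X0\<close>. From a
  bounded region one Gaussian step reaches the neighbourhood with probability bounded below. Drift and capture together make the mean of
  \<open>1 + \<kappa> (F Y - F xstar)\<close>, restricted to the event that \<open>X\<close> has not entered \<open>B\<^sub>0\<close>, contract in every step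
  (\<open>obtain_escape_contraction\<close>). This accounts for the \<open>log (1/\<delta>)\<close> term.

  All of this uses \<open>h L \<le> 1\<close>, and the rates obtained depend on \<open>F\<close>, \<open>\<gamma>\<close>, \<open>h\<close> and \<open>X0\<close> but not on \<open>\<beta>\<close>. The log-Sobolev
  inequality enters through the bound \<open>\<beta> \<gamma> \<le> 36 L\<close> (\<open>log_sobolev_constant_le\<close>): because the
  gradient of \<open>F\<close> is \<open>L\<close>-Lipschitz, the Gibbs measure is at least as spread out as a Gaussian of variance
  \<open>\<gamma> / L\<close>, which limits its log-Sobolev constant. Inserted into the step bound this gives \<open>h L \<le> 1\<close>; and since \<open>\<beta>\<close> is bounded above, a time of
  order \<open>log (1/\<delta>)\<close> is also of order \<open>log (1/\<delta>) / \<beta>\<close>, and of the order of \<open>K_blocks\<close> times \<open>n_block\<close>, which is a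
  fixed multiple of the latter.\<close>

section \<open>Functions with Lipschitz gradient\<close>

locale lipschitz_gradient =
  fixes F :: "'a::euclidean_space \<Rightarrow> real" and L :: real
  assumes differentiable: "\<And>x. F differentiable (at x)"
    and smooth: "smooth_gradient F L"
begin

lemma L_pos: "0 < L"
  using smooth by (simp add: smooth_gradient_def)

lemma grad_lipschitz: "norm (grad F x - grad F y) \<le> L * norm (x - y)"
  using smooth by (simp add: smooth_gradient_def)

lemma has_derivative_grad: "(F has_derivative (\<lambda>v. v \<bullet> grad F x)) (at x)"
  using GDERIV_grad[OF differentiable] by (simp add: gderiv_def)

lemma continuous_on_F: "continuous_on S F"
  by (meson differentiable continuous_at_imp_continuous_on differentiable_imp_continuous_within)

lemma continuous_on_grad: "continuous_on S (grad F)"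
proof -
  have "L-lipschitz_on UNIV (grad F)"
    using grad_lipschitz L_pos by (auto simp: lipschitz_on_def dist_norm)
  then show ?thesis
    by (meson continuous_on_subset lipschitz_on_continuous_on subset_UNIV)
qed

lemma borel_measurable_F [measurable]: "F \<in> borel_measurable borel"
  by (rule borel_measurable_continuous_onI[OF continuous_on_F])

lemma borel_measurable_grad [measurable]: "grad F \<in> borel_measurable borel"
  by (rule borel_measurable_continuous_onI[OF continuous_on_grad])

lemma DERIV_along_line:
  "((\<lambda>t. F (x + t *\<^sub>R v)) has_real_derivative (v \<bullet> grad F (x + t *\<^sub>R v))) (at t)"
proof -
  have "((\<lambda>t. F (x + t *\<^sub>R v)) has_derivative (\<lambda>s. (s *\<^sub>R v) \<bullet> grad F (x + t *\<^sub>R v))) (at t)"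
    by (rule has_derivative_compose[where f = "\<lambda>t. x + t *\<^sub>R v", OF _ has_derivative_grad])
      (auto intro!: derivative_eq_intros)
  moreover have "(\<lambda>s. (s *\<^sub>R v) \<bullet> grad F (x + t *\<^sub>R v)) = (*) (v \<bullet> grad F (x + t *\<^sub>R v))"
    by (auto simp: mult.commute)
  ultimately show ?thesis
    by (simp add: has_field_derivative_def)
qed

lemma descent: "F (x + v) \<le> F x + v \<bullet> grad F x + L / 2 * (norm v)\<^sup>2"
proof -
  define \<phi> where "\<phi> t = F (x + t *\<^sub>R v) - t * (v \<bullet> grad F x) - L / 2 * t\<^sup>2 * (norm v)\<^sup>2" for t
  have "\<phi> 1 \<le> \<phi> 0"
  proof (rule DERIV_nonpos_imp_nonincreasing[where f = \<phi>])
    fix t :: real assume t: "0 \<le> t" "t \<le> 1"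
    have D: "(\<phi> has_real_derivative
        (v \<bullet> grad F (x + t *\<^sub>R v) - v \<bullet> grad F x - L * t * (norm v)\<^sup>2)) (at t)"
      unfolding \<phi>_def by (auto intro!: derivative_eq_intros DERIV_along_line)
    have "v \<bullet> grad F (x + t *\<^sub>R v) - v \<bullet> grad F x = v \<bullet> (grad F (x + t *\<^sub>R v) - grad F x)"
      by (simp add: inner_diff_right)
    also have "\<dots> \<le> norm v * norm (grad F (x + t *\<^sub>R v) - grad F x)"
      by (rule norm_cauchy_schwarz)
    also have "\<dots> \<le> norm v * (L * norm (t *\<^sub>R v))"
      using grad_lipschitz[of "x + t *\<^sub>R v" x] by (intro mult_left_mono) auto
    also have "\<dots> = L * t * (norm v)\<^sup>2"
      using t by (simp add: power2_eq_square)
    finally show "\<exists>y. (\<phi> has_real_derivative y) (at t) \<and> y \<le> 0"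
      using D by (intro exI[of _ "v \<bullet> grad F (x + t *\<^sub>R v) - v \<bullet> grad F x - L * t * (norm v)\<^sup>2"]) auto
  qed simp
  then show ?thesis
    by (simp add: \<phi>_def)
qed

lemma gradient_step_decrease:
  assumes "0 < h" "h * L \<le> 1"
  shows "F (x - h *\<^sub>R grad F x) \<le> F x - h / 2 * (norm (grad F x))\<^sup>2"
proof -
  let ?G = "(norm (grad F x))\<^sup>2"
  have "F (x - h *\<^sub>R grad F x) \<le> F x - h * ?G + L / 2 * (h\<^sup>2 * ?G)"
    using descent[of x "- h *\<^sub>R grad F x"]
    by (simp add: power_mult_distrib power2_norm_eq_inner)
  moreover have "L / 2 * (h\<^sup>2 * ?G) = (h * L) * (h / 2 * ?G)"
    by (simp add: power2_eq_square)
  moreover have "(h * L) * (h / 2 * ?G) \<le> 1 * (h / 2 * ?G)"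
    using assms by (intro mult_right_mono) auto
  ultimately show ?thesis by linarith
qed

text \<open>The cross term \<open>(1 - h L) (v \<bullet> grad F x)\<close> is absorbed into half of the decrease by Young's
  inequality, at the price of the factor \<open>1 / h\<close> in front of \<open>\<parallel>v\<parallel>\<^sup>2\<close>. The bound therefore holds for every
  noise vector \<open>v\<close>, and later only the second moment of the noise enters, not its mean.\<close>

lemma noisy_gradient_step:
  assumes "0 < h" "h * L \<le> 1"
  shows "F (x - h *\<^sub>R grad F x + v)
    \<le> F x - h / 4 * (norm (grad F x))\<^sup>2 + (1 / h + L / 2) * (norm v)\<^sup>2"
proof -
  define g G N P Q where defs: "g = grad F x" "G = (norm g)\<^sup>2" "N = (norm v)\<^sup>2" "P = v \<bullet> g"
    "Q = norm v * norm g"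
  have "(norm (v - h *\<^sub>R g))\<^sup>2 = N - 2 * h * P + h\<^sup>2 * G"
    unfolding power2_norm_eq_inner defs by (simp add: algebra_simps inner_commute power2_eq_square)
  moreover have "(v - h *\<^sub>R g) \<bullet> g = P - h * G"
    unfolding defs by (simp add: inner_diff_left power2_norm_eq_inner)
  ultimately have "F (x + (v - h *\<^sub>R g)) \<le> F x + (P - h * G) + L / 2 * (N - 2 * h * P + h\<^sup>2 * G)"
    using descent[of x "v - h *\<^sub>R g"] by (simp add: defs(1))
  also have "\<dots> = F x - h * G + (h * L) * (h / 2 * G) + (1 - h * L) * P + L / 2 * N"
    by (simp add: field_simps power2_eq_square)
  also have "\<dots> \<le> F x - h * G + h / 2 * G + (N / h + h / 4 * G) + L / 2 * N"
  proof -
    have "(h * L) * (h / 2 * G) \<le> 1 * (h / 2 * G)"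
      using assms by (intro mult_right_mono) (auto simp: defs)
    moreover have "(1 - h * L) * P \<le> Q"
    proof -
      have "\<bar>(1 - h * L) * P\<bar> \<le> 1 * \<bar>P\<bar>"
        unfolding abs_mult using assms L_pos by (intro mult_right_mono) auto
      moreover have "\<bar>P\<bar> \<le> Q"
        unfolding defs by (rule Cauchy_Schwarz_ineq2)
      ultimately show ?thesis by linarith
    qed
    moreover have "Q \<le> N / h + h / 4 * G"
    proof -
      have "0 \<le> (norm v - h / 2 * norm g)\<^sup>2 / h"
        using assms by simp
      also have "\<dots> = N / h + h / 4 * G - Q"
        unfolding defs using assms by (simp add: power2_eq_square field_simps)
      finally show ?thesis by simp
    qed
    ultimately show ?thesis by linarith
  qed
  also have "\<dots> = F x - h / 4 * G + (1 / h + L / 2) * N"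
    by (simp add: field_simps)
  finally show ?thesis
    unfolding defs by (simp add: add.commute add_diff_eq)
qed

text \<open>A gradient step of length \<open>1 / L\<close> cannot go below a lower bound of \<open>F\<close>.\<close>

lemma norm_grad_le:
  assumes "\<And>y. m \<le> F y"
  shows "(norm (grad F x))\<^sup>2 \<le> 2 * L * (F x - m)"
proof -
  have "F (x - (1 / L) *\<^sub>R grad F x) \<le> F x - (1 / L) / 2 * (norm (grad F x))\<^sup>2"
    using L_pos by (intro gradient_step_decrease) auto
  then have "(norm (grad F x))\<^sup>2 / (2 * L) \<le> F x - m"
    using assms[of "x - (1 / L) *\<^sub>R grad F x"] by simp
  then show ?thesis
    using L_pos by (simp add: divide_le_eq mult.commute)
qed

end

section \<open>An upper bound for the log-Sobolev constant\<close>

lemma GDERIV_sin_inner: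
  "GDERIV (\<lambda>x. a + b * sin (\<theta> * (x \<bullet> e) + \<alpha>)) x :> (b * \<theta> * cos (\<theta> * (x \<bullet> e) + \<alpha>)) *\<^sub>R e"
  unfolding gderiv_def
  by (auto intro!: derivative_eq_intros simp: mult_ac)

text \<open>A directional derivative of such a function is again of this form, with the phase advanced by
  a quarter period; this is why the amplitude, the offset and the phase are all parameters.\<close>

lemma smooth_sin_inner:
  fixes e :: "'a::euclidean_space"
  shows "smooth (\<lambda>x. a + b * sin (\<theta> * (x \<bullet> e) + \<alpha>))"
proof -
  have "C_k k (\<lambda>x::'a. a + b * sin (\<theta> * (x \<bullet> e) + \<alpha>))" for k a b \<alpha>
  proof (induction k arbitrary: a b \<alpha>)
    case 0
    show ?case by (auto intro!: continuous_intros)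
  next
    case (Suc k)
    have D: "((\<lambda>x. a + b * sin (\<theta> * (x \<bullet> e) + \<alpha>)) has_derivative
        (\<lambda>v. v \<bullet> (b * \<theta> * cos (\<theta> * (x \<bullet> e) + \<alpha>)) *\<^sub>R e)) (at x)" for x
      using GDERIV_sin_inner unfolding gderiv_def .
    have "v \<bullet> (b * \<theta> * cos (\<theta> * (x \<bullet> e) + \<alpha>)) *\<^sub>R e
        = 0 + (b * \<theta> * (v \<bullet> e)) * sin (\<theta> * (x \<bullet> e) + (\<alpha> + pi / 2))" for x v
      unfolding add.assoc[symmetric] by (simp add: sin_add)
    then have "(\<lambda>x. frechet_derivative (\<lambda>x. a + b * sin (\<theta> * (x \<bullet> e) + \<alpha>)) (at x) v)
        = (\<lambda>x. 0 + (b * \<theta> * (v \<bullet> e)) * sin (\<theta> * (x \<bullet> e) + (\<alpha> + pi / 2)))" for v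
      unfolding frechet_derivative_at[OF D, symmetric] by blast
    moreover have "(\<lambda>x. a + b * sin (\<theta> * (x \<bullet> e) + \<alpha>)) differentiable_on UNIV"
      unfolding differentiable_on_def using D differentiableI by blast
    ultimately show ?case
      using Suc.IH by (simp only: C_k.simps) blast
  qed
  then show ?thesis by (simp add: smooth_def)
qed

text \<open>With \<open>s\<^sup>2\<close> the mean of \<open>f\<^sup>2\<close>, the inequality \<open>ln u \<le> u - 1\<close> at \<open>u = s / f\<close> gives
  \<open>f\<^sup>2 ln (f\<^sup>2 / s\<^sup>2) \<ge> 2 f\<^sup>2 - 2 s f\<close>. The mean of the right side is \<open>2 s (s - \<mu>)\<close>, where \<open>\<mu>\<close> is the mean
  of \<open>f\<close>, and it exceeds the variance \<open>s\<^sup>2 - \<mu>\<^sup>2\<close> by \<open>(s - \<mu>)\<^sup>2\<close>. So a log-Sobolev inequality implies a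
  Poincare inequality, up to a factor of two, by testing with the function itself: no
  linearization \<open>f = 1 + t g\<close>, \<open>t \<rightarrow> 0\<close>, is involved.\<close>

lemma (in prob_space) variance_le_entropy_square:
  fixes f :: "'a \<Rightarrow> real"
  assumes [measurable]: "f \<in> borel_measurable M" and bounds: "\<And>x. a \<le> f x" "\<And>x. f x \<le> b" and "0 < a"
  shows "variance f \<le> (\<integral>x. (f x)\<^sup>2 * ln ((f x)\<^sup>2) \<partial>M) - (\<integral>x. (f x)\<^sup>2 \<partial>M) * ln (\<integral>x. (f x)\<^sup>2 \<partial>M)"
    and "integrable M f" "integrable M (\<lambda>x. (f x)\<^sup>2)" "integrable M (\<lambda>x. (f x)\<^sup>2 * ln ((f x)\<^sup>2))"
proof -
  have pos: "0 < f x" for x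
    using bounds(1)[of x] \<open>0 < a\<close> by linarith
  show int_f: "integrable M f"
    by (rule integrable_const_bound[where B = b]) (use pos bounds in \<open>auto simp: abs_of_pos\<close>)
  have sq: "a\<^sup>2 \<le> (f x)\<^sup>2" "(f x)\<^sup>2 \<le> b\<^sup>2" for x
    using bounds[of x] pos[of x] \<open>0 < a\<close> by (auto intro!: power_mono)
  show int_f2: "integrable M (\<lambda>x. (f x)\<^sup>2)"
    by (rule integrable_const_bound[where B = "b\<^sup>2"]) (use sq in auto)
  have sq_pos: "0 < a\<^sup>2" "0 < (f x)\<^sup>2" for x
    using \<open>0 < a\<close> pos[of x] by (auto intro: zero_less_power)
  have ln_bounds: "ln (a\<^sup>2) \<le> ln ((f x)\<^sup>2)" "ln ((f x)\<^sup>2) \<le> ln (b\<^sup>2)" for x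
    using sq[of x] sq_pos(1) sq_pos(2)[of x] by (auto intro: ln_mono simp del: ln_le_cancel_iff)
  show int_ln: "integrable M (\<lambda>x. (f x)\<^sup>2 * ln ((f x)\<^sup>2))"
  proof (rule integrable_const_bound[where B = "b\<^sup>2 * (\<bar>ln (a\<^sup>2)\<bar> + \<bar>ln (b\<^sup>2)\<bar>)"])
    have "\<bar>ln ((f x)\<^sup>2)\<bar> \<le> \<bar>ln (a\<^sup>2)\<bar> + \<bar>ln (b\<^sup>2)\<bar>" for x
      using ln_bounds[of x] by linarith
    then have "norm ((f x)\<^sup>2 * ln ((f x)\<^sup>2)) \<le> b\<^sup>2 * (\<bar>ln (a\<^sup>2)\<bar> + \<bar>ln (b\<^sup>2)\<bar>)" for x
      using sq(2)[of x] by (auto simp: abs_mult intro!: mult_mono)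
    then show "AE x in M. norm ((f x)\<^sup>2 * ln ((f x)\<^sup>2)) \<le> b\<^sup>2 * (\<bar>ln (a\<^sup>2)\<bar> + \<bar>ln (b\<^sup>2)\<bar>)"
      by simp
  qed simp
  define m where "m = expectation (\<lambda>x. (f x)\<^sup>2)"
  define s where "s = sqrt m"
  have "a\<^sup>2 \<le> m"
    unfolding m_def using sq(1) by (intro integral_ge_const[OF int_f2]) auto
  then have m_pos: "0 < m"
    using \<open>0 < a\<close> by (smt (verit) zero_less_power)
  then have s: "0 < s" "s\<^sup>2 = m" by (auto simp: s_def)
  have pointwise: "2 * (f x)\<^sup>2 - 2 * s * f x \<le> (f x)\<^sup>2 * ln ((f x)\<^sup>2) - (f x)\<^sup>2 * ln m" for x
  proof -
    have "ln (s / f x) \<le> s / f x - 1"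
      using s pos[of x] by (intro ln_le_minus_one) auto
    moreover have "ln (s / f x) = ln s - ln (f x)"
      using s pos[of x] by (simp add: ln_div)
    ultimately have "(f x)\<^sup>2 * (1 - s / f x) \<le> (f x)\<^sup>2 * (ln (f x) - ln s)"
      by (intro mult_left_mono) auto
    moreover have "(f x)\<^sup>2 * (1 - s / f x) = (f x)\<^sup>2 - s * f x"
      using pos[of x] by (simp add: field_simps power2_eq_square)
    moreover have "ln ((f x)\<^sup>2) = 2 * ln (f x)" "ln m = 2 * ln s"
      using pos[of x] s by (auto simp: ln_realpow simp flip: s(2))
    ultimately show ?thesis by (simp add: algebra_simps)
  qed
  have "expectation (\<lambda>x. 2 * (f x)\<^sup>2 - 2 * s * f x)
      \<le> expectation (\<lambda>x. (f x)\<^sup>2 * ln ((f x)\<^sup>2) - (f x)\<^sup>2 * ln m)"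
    using pointwise by (intro integral_mono) (auto intro!: int_f int_f2 int_ln)
  then have "2 * m - 2 * s * expectation f \<le> expectation (\<lambda>x. (f x)\<^sup>2 * ln ((f x)\<^sup>2)) - m * ln m"
    using int_f int_f2 int_ln by (simp add: m_def)
  moreover have "variance f = m - (expectation f)\<^sup>2"
    unfolding m_def by (rule variance_eq[OF int_f int_f2])
  moreover have "m - (expectation f)\<^sup>2 \<le> 2 * m - 2 * s * expectation f"
    using zero_le_power2[of "s - expectation f"] s(2) by (simp add: power2_diff)
  ultimately show "variance f
      \<le> (\<integral>x. (f x)\<^sup>2 * ln ((f x)\<^sup>2) \<partial>M) - (\<integral>x. (f x)\<^sup>2 \<partial>M) * ln (\<integral>x. (f x)\<^sup>2 \<partial>M)"
    by (simp add: m_def)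
qed

lemma pi_le_3_2: "pi \<le> 16 / 5"
proof (rule ccontr)
  assume "\<not> pi \<le> 16 / 5"
  then have "0 < cos (8 / 5 :: real)"
    by (intro cos_gt_zero) auto
  moreover obtain t :: real where
    "cos (8 / 5 :: real) = (\<Sum>m<8. cos_coeff m * (8 / 5) ^ m) + cos (t + 1 / 2 * real 8 * pi) / fact 8 * (8 / 5) ^ 8"
    using Maclaurin_cos_expansion2[of "8 / 5" 8] by auto
  moreover have "cos (t + 1 / 2 * real 8 * pi) / fact 8 * (8 / 5) ^ 8 \<le> 1 / fact 8 * (8 / 5) ^ 8"
    by (intro mult_right_mono divide_right_mono) auto
  ultimately have "0 < (\<Sum>m<8. cos_coeff m * (8 / 5 :: real) ^ m) + 1 / fact 8 * (8 / 5) ^ 8"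
    by linarith
  then show False
    by (simp add: cos_coeff_def lessThan_nat_numeral fact_numeral power_divide)
qed

context lipschitz_gradient
begin

text \<open>A Gibbs measure that charges some set is not the zero measure that stands for a failed
  normalization, hence it is a genuine probability measure.\<close>

lemma gibbs_normalized:
  assumes "0 < measure (gibbs F \<gamma>) S"
  shows "integrable lborel (\<lambda>x. exp (- F x / \<gamma>))" and "0 < (\<integral>x. exp (- F x / \<gamma>) \<partial>lborel)"
    and "prob_space (gibbs F \<gamma>)"
proof -
  let ?w = "\<lambda>x. exp (- F x / \<gamma>)"
  have Z_nonzero: "(\<integral>x. ?w x \<partial>lborel) \<noteq> 0"
  proof
    assume "(\<integral>x. ?w x \<partial>lborel) = 0"
    then have "emeasure (gibbs F \<gamma>) S \<le> emeasure (density (lborel :: 'a measure) (\<lambda>_. 0)) UNIV"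
      by (simp add: gibbs_def emeasure_mono)
    then have "emeasure (gibbs F \<gamma>) S = 0"
      by (simp add: emeasure_density)
    with assms show False
      by (simp add: measure_def)
  qed
  then show int: "integrable lborel ?w"
    using not_integrable_integral_eq by blast
  have "0 \<le> (\<integral>x. ?w x \<partial>lborel)"
    by simp
  with Z_nonzero show pos: "0 < (\<integral>x. ?w x \<partial>lborel)"
    by linarith
  have "emeasure (gibbs F \<gamma>) UNIV = (\<integral>\<^sup>+x. ennreal (?w x / (\<integral>y. ?w y \<partial>lborel)) \<partial>lborel)"
    by (simp add: gibbs_def emeasure_density)
  also have "\<dots> = ennreal (\<integral>x. ?w x / (\<integral>y. ?w y \<partial>lborel) \<partial>lborel)"
    using int pos by (intro nn_integral_eq_integral) auto
  also have "\<dots> = 1"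
    using pos by simp
  finally show "prob_space (gibbs F \<gamma>)"
    by (intro prob_spaceI) (simp add: gibbs_def)
qed

text \<open>The linear terms of the two descent bounds at \<open>x\<close> have opposite signs and cancel in the sum
  because \<open>exp (- s) + exp s \<ge> 2\<close>. In this sense the Gibbs measure is at least as spread out as a
  Gaussian of variance \<open>\<gamma> / L\<close>.\<close>

lemma gibbs_shift_lower_bound:
  assumes "0 < \<gamma>"
  shows "2 * exp (- (L * (norm u)\<^sup>2 / (2 * \<gamma>))) * exp (- F x / \<gamma>)
    \<le> exp (- F (x + u) / \<gamma>) + exp (- F (x - u) / \<gamma>)"
proof -
  define l where "l = L * (norm u)\<^sup>2 / (2 * \<gamma>)"
  define s where "s = (u \<bullet> grad F x) / \<gamma>"
  have "F (x + u) / \<gamma> \<le> (F x + u \<bullet> grad F x + L / 2 * (norm u)\<^sup>2) / \<gamma>"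
    using descent[of x u] assms by (intro divide_right_mono) auto
  then have plus: "exp (- F x / \<gamma> - l) * exp (- s) \<le> exp (- F (x + u) / \<gamma>)"
    using assms by (simp add: l_def s_def add_divide_distrib flip: exp_add)
  have "F (x - u) / \<gamma> \<le> (F x - u \<bullet> grad F x + L / 2 * (norm u)\<^sup>2) / \<gamma>"
    using descent[of x "- u"] assms by (intro divide_right_mono) auto
  then have minus: "exp (- F x / \<gamma> - l) * exp s \<le> exp (- F (x - u) / \<gamma>)"
    using assms by (simp add: l_def s_def add_divide_distrib diff_divide_distrib flip: exp_add)
  have "2 \<le> exp (- s) + exp s"
    using exp_ge_add_one_self[of s] exp_ge_add_one_self[of "- s"] by linarith
  then have "exp (- F x / \<gamma> - l) * 2 \<le> exp (- F x / \<gamma> - l) * (exp (- s) + exp s)"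
    by (intro mult_left_mono) auto
  moreover have "exp (- F x / \<gamma> - l) = exp (- l) * exp (- F x / \<gamma>)"
    by (simp flip: exp_add)
  ultimately show ?thesis
    using plus minus unfolding l_def[symmetric] by (simp add: distrib_left)
qed

text \<open>Translation by half a period \<open>u\<close> turns \<open>g = sin (\<theta> (x \<bullet> e) + \<alpha>)\<close> into \<open>- g\<close>. So, with \<open>q\<close> the Gibbs
  density, the integral of \<open>(g - c)\<^sup>2 q(x)\<close> equals the integrals of \<open>(g + c)\<^sup>2 q(x + u)\<close> and of
  \<open>(g + c)\<^sup>2 q(x - u)\<close>. Averaging these expressions and bounding \<open>q(x + u) + q(x - u)\<close> from below by
  \<open>2 \<kappa> q(x)\<close> leaves \<open>\<kappa>\<close> times the integral of \<open>g\<^sup>2 + c\<^sup>2\<close>.\<close>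

lemma gibbs_variance_sin:
  assumes "0 < \<gamma>" "\<theta> \<noteq> 0" "norm e = 1"
    and int: "integrable lborel (\<lambda>x. exp (- F x / \<gamma>))"
  shows "exp (- (L * pi\<^sup>2 / (2 * \<gamma> * \<theta>\<^sup>2))) * (\<integral>x. (sin (\<theta> * (x \<bullet> e) + \<alpha>))\<^sup>2 \<partial>gibbs F \<gamma>)
    \<le> (\<integral>x. (sin (\<theta> * (x \<bullet> e) + \<alpha>) - c)\<^sup>2 \<partial>gibbs F \<gamma>)"
proof -
  define q where "q x = exp (- F x / \<gamma>) / (\<integral>y. exp (- F y / \<gamma>) \<partial>lborel)" for x
  define g where "g x = sin (\<theta> * (x \<bullet> e) + \<alpha>)" for x
  define u where "u = (pi / \<theta>) *\<^sub>R e"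
  define \<kappa> where "\<kappa> = exp (- (L * pi\<^sup>2 / (2 * \<gamma> * \<theta>\<^sup>2)))"
  have [measurable]: "q \<in> borel_measurable borel" "g \<in> borel_measurable borel"
    unfolding q_def g_def by measurable
  have Z_nonneg: "0 \<le> (\<integral>y. exp (- F y / \<gamma>) \<partial>lborel)"
    by simp
  then have q_nonneg: "0 \<le> q x" for x
    by (simp add: q_def)
  have int_q: "integrable lborel q"
    unfolding q_def using int by simp
  have gibbs_integral: "(\<integral>x. f x \<partial>gibbs F \<gamma>) = (\<integral>x. f x * q x \<partial>lborel)"
    if [measurable]: "f \<in> borel_measurable borel" for f :: "'a \<Rightarrow> real"
    unfolding gibbs_def q_def[symmetric]
    by (subst integral_density) (auto simp: q_nonneg mult.commute)
  have g_bound: "\<bar>g x\<bar> \<le> 1" for x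
    by (simp add: g_def)
  have half_period: "g (x + u) = - g x" "g (x - u) = - g x" for x
  proof -
    have "u \<bullet> e = pi / \<theta>"
      using assms(3) by (simp add: u_def norm_eq_1)
    then have eq: "\<theta> * ((x + u) \<bullet> e) + \<alpha> = (\<theta> * (x \<bullet> e) + \<alpha>) + pi"
        "\<theta> * ((x - u) \<bullet> e) + \<alpha> = (\<theta> * (x \<bullet> e) + \<alpha>) - pi"
      using assms(2) by (simp_all add: inner_add_left inner_diff_left distrib_left right_diff_distrib)
    then show "g (x + u) = - g x" "g (x - u) = - g x"
      unfolding g_def eq by (simp_all add: sin_diff del: add.assoc)
  qed
  have norm_u: "L * (norm u)\<^sup>2 / (2 * \<gamma>) = L * pi\<^sup>2 / (2 * \<gamma> * \<theta>\<^sup>2)"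
    using assms(3) by (simp add: u_def power_divide)
  have q_shift: "2 * \<kappa> * q x \<le> q (x + u) + q (x - u)" for x
    using divide_right_mono[OF gibbs_shift_lower_bound[OF assms(1), of u x] Z_nonneg]
    unfolding norm_u \<kappa>_def[symmetric] by (simp add: q_def add_divide_distrib)
  have \<kappa>: "0 < \<kappa>" "\<kappa> \<le> 1"
    using assms(1) L_pos by (auto simp: \<kappa>_def)
  have shift: "(\<integral>x. f (v + x) \<partial>lborel) = (\<integral>x. f x \<partial>lborel)"
      "integrable lborel (\<lambda>x. f (v + x)) \<longleftrightarrow> integrable lborel f"
    if [measurable]: "f \<in> borel_measurable borel" for f :: "'a \<Rightarrow> real" and v
    using integral_distr[of "(+) v" lborel borel f] integrable_distr_eq[of "(+) v" lborel borel f]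
    by (simp_all add: lborel_distr_plus)
  have int_bounded: "integrable lborel (\<lambda>x. f x * q x)"
    if [measurable]: "f \<in> borel_measurable borel" and "\<And>x. \<bar>f x\<bar> \<le> B" for f :: "'a \<Rightarrow> real" and B
  proof (rule Bochner_Integration.integrable_bound)
    show "integrable lborel (\<lambda>x. B * q x)"
      using int_q by simp
    have "norm (f x * q x) \<le> norm (B * q x)" for x
      using that(2)[of x] q_nonneg[of x] by (auto simp: abs_mult intro!: mult_right_mono)
    then show "AE x in lborel. norm (f x * q x) \<le> norm (B * q x)"
      by simp
  qed measurable
  let ?D = "\<lambda>x. (g x - c)\<^sup>2" and ?E = "\<lambda>x. (g x + c)\<^sup>2"
  have DE_bound: "\<bar>?D x\<bar> \<le> (1 + \<bar>c\<bar>)\<^sup>2" "\<bar>?E x\<bar> \<le> (1 + \<bar>c\<bar>)\<^sup>2" for x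
    using g_bound[of x] by (auto simp: abs_le_square_iff[symmetric])
  have int_D: "integrable lborel (\<lambda>x. ?D x * q x)" and int_E: "integrable lborel (\<lambda>x. ?E x * q x)"
    by (rule int_bounded[where B = "(1 + \<bar>c\<bar>)\<^sup>2"], simp, rule DE_bound)+
  have int_g: "integrable lborel (\<lambda>x. (g x)\<^sup>2 * q x)"
    by (rule int_bounded[where B = 1]) (use g_bound in \<open>auto simp: abs_square_le_1\<close>)
  have flip: "(- a - c)\<^sup>2 = (a + c)\<^sup>2" for a
    by (simp add: power2_eq_square algebra_simps)
  have shift_plus: "(\<integral>x. ?E x * q (x + u) \<partial>lborel) = (\<integral>x. ?D x * q x \<partial>lborel)"
      "integrable lborel (\<lambda>x. ?E x * q (x + u))"
    using shift[of "\<lambda>x. ?D x * q x" u] int_D by (simp_all add: add.commute[of u] half_period flip)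
  have shift_minus: "(\<integral>x. ?E x * q (x - u) \<partial>lborel) = (\<integral>x. ?D x * q x \<partial>lborel)"
      "integrable lborel (\<lambda>x. ?E x * q (x - u))"
    using shift[of "\<lambda>x. ?D x * q x" "- u"] int_D by (simp_all add: half_period flip)
  have pointwise: "4 * \<kappa> * ((g x)\<^sup>2 * q x) \<le> 2 * (?D x * q x) + (?E x * q (x + u) + ?E x * q (x - u))" for x
  proof -
    have "\<kappa> * (?D x * q x) \<le> 1 * (?D x * q x)"
      using \<kappa> q_nonneg[of x] by (intro mult_right_mono) auto
    moreover have "?E x * (2 * \<kappa> * q x) \<le> ?E x * (q (x + u) + q (x - u))"
      using q_shift by (intro mult_left_mono) auto
    moreover have "0 \<le> 4 * \<kappa> * (c\<^sup>2 * q x)"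
      using \<kappa> q_nonneg[of x] by simp
    moreover have "2 * (\<kappa> * (?D x * q x)) + ?E x * (2 * \<kappa> * q x) = 4 * \<kappa> * ((g x)\<^sup>2 * q x) + 4 * \<kappa> * (c\<^sup>2 * q x)"
      by (simp add: power2_eq_square algebra_simps)
    ultimately show ?thesis
      by (simp only: distrib_left)
  qed
  have "4 * \<kappa> * (\<integral>x. (g x)\<^sup>2 * q x \<partial>lborel) = (\<integral>x. 4 * \<kappa> * ((g x)\<^sup>2 * q x) \<partial>lborel)"
    using int_g by simp
  also have "\<dots> \<le> (\<integral>x. 2 * (?D x * q x) + (?E x * q (x + u) + ?E x * q (x - u)) \<partial>lborel)"
    using pointwise int_g int_D shift_plus(2) shift_minus(2) by (intro integral_mono) auto
  also have "\<dots> = 4 * (\<integral>x. ?D x * q x \<partial>lborel)"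
    using int_D shift_plus shift_minus by simp
  finally have "\<kappa> * (\<integral>x. (g x)\<^sup>2 * q x \<partial>lborel) \<le> (\<integral>x. ?D x * q x \<partial>lborel)"
    by simp
  moreover have "(\<integral>x. (g x)\<^sup>2 \<partial>gibbs F \<gamma>) = (\<integral>x. (g x)\<^sup>2 * q x \<partial>lborel)"
      "(\<integral>x. ?D x \<partial>gibbs F \<gamma>) = (\<integral>x. ?D x * q x \<partial>lborel)"
    by (rule gibbs_integral, measurable)+
  ultimately show ?thesis
    unfolding \<kappa>_def g_def by simp
qed

text \<open>The log-Sobolev inequality, tested with \<open>2 + sin (\<theta> (x \<bullet> e))\<close> and \<open>2 + cos (\<theta> (x \<bullet> e))\<close>, bounds
  the variances of sine and cosine by \<open>2 \<theta>\<^sup>2 / \<beta>\<close> times the means of \<open>cos\<^sup>2\<close> and \<open>sin\<^sup>2\<close>. These means add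
  up to one, so the two inequalities combine to \<open>\<kappa> \<le> 2 \<theta>\<^sup>2 / \<beta>\<close> with \<open>\<kappa>\<close> from the previous lemma. The
  frequency \<open>\<theta>\<^sup>2 = L \<pi>\<^sup>2 / (2 \<gamma>)\<close> makes \<open>\<kappa> = exp (- 1)\<close> and gives \<open>\<beta> \<gamma> \<le> e \<pi>\<^sup>2 L\<close>. The constant
  \<open>36\<close> is the square of the \<open>6\<close> in the admissible step size, which is what the bound is compared with.\<close>

lemma log_sobolev_constant_le:
  assumes "0 < \<gamma>" "0 < \<beta>" and LSI: "log_sobolev (gibbs F \<gamma>) \<beta>"
    and mass: "0 < measure (gibbs F \<gamma>) S"
  shows "\<beta> * \<gamma> \<le> 36 * L"
proof -
  interpret G: prob_space "gibbs F \<gamma>"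
    by (rule gibbs_normalized(3)[OF mass])
  have sets_gibbs [measurable_cong]: "sets (gibbs F \<gamma>) = sets borel"
    by (simp add: gibbs_def)
  obtain e :: 'a where e: "norm e = 1"
    using norm_Basis nonempty_Basis by blast
  define \<theta> where "\<theta> = pi * sqrt (L / (2 * \<gamma>))"
  have \<theta>_sq: "\<theta>\<^sup>2 = L * pi\<^sup>2 / (2 * \<gamma>)" and "\<theta> \<noteq> 0"
    using assms(1) L_pos by (simp_all add: \<theta>_def power_mult_distrib)
  then have rate: "L * pi\<^sup>2 / (2 * \<gamma> * \<theta>\<^sup>2) = 1"
    using assms(1) L_pos by simp
  have key: "exp (- 1) * (\<integral>x. (sin (\<theta> * (x \<bullet> e) + \<alpha>))\<^sup>2 \<partial>gibbs F \<gamma>)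
      \<le> 2 / \<beta> * (\<theta>\<^sup>2 * (\<integral>x. (cos (\<theta> * (x \<bullet> e) + \<alpha>))\<^sup>2 \<partial>gibbs F \<gamma>))" for \<alpha>
  proof -
    \<comment> \<open>The offset keeps the test function positive, so that its logarithm is bounded.\<close>
    let ?f = "\<lambda>x. 2 + 1 * sin (\<theta> * (x \<bullet> e) + \<alpha>)"
    have f_meas: "?f \<in> borel_measurable (gibbs F \<gamma>)"
      by measurable
    have f_bounds: "1 \<le> ?f x" "?f x \<le> 3" for x
      using sin_ge_minus_one[of "\<theta> * (x \<bullet> e) + \<alpha>"] sin_le_one[of "\<theta> * (x \<bullet> e) + \<alpha>"] by linarith+
    note ent = G.variance_le_entropy_square[of ?f 1 3, OF f_meas f_bounds zero_less_one]
    have norm_grad: "(norm (grad ?f x))\<^sup>2 = \<theta>\<^sup>2 * (cos (\<theta> * (x \<bullet> e) + \<alpha>))\<^sup>2" for x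
      using grad_eqI[OF GDERIV_sin_inner[of 2 1 \<theta> e \<alpha> x]] e by (simp add: power_mult_distrib)
    have "integrable (gibbs F \<gamma>) (\<lambda>x. (norm (grad ?f x))\<^sup>2)"
      unfolding norm_grad
      by (rule G.integrable_const_bound[where B = "\<theta>\<^sup>2"])
        (auto intro!: mult_left_le simp: abs_square_le_1)
    moreover have "smooth ?f"
      by (rule smooth_sin_inner)
    ultimately have "(\<integral>x. (?f x)\<^sup>2 * ln ((?f x)\<^sup>2) \<partial>gibbs F \<gamma>)
          - (\<integral>x. (?f x)\<^sup>2 \<partial>gibbs F \<gamma>) * ln (\<integral>x. (?f x)\<^sup>2 \<partial>gibbs F \<gamma>)
        \<le> 2 / \<beta> * (\<integral>x. (norm (grad ?f x))\<^sup>2 \<partial>gibbs F \<gamma>)"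
      using LSI[unfolded log_sobolev_def, rule_format, of ?f] ent(3,4) by blast
    with ent(1) have "G.variance ?f \<le> 2 / \<beta> * (\<integral>x. (norm (grad ?f x))\<^sup>2 \<partial>gibbs F \<gamma>)"
      by (rule order_trans)
    moreover have "(\<integral>x. (norm (grad ?f x))\<^sup>2 \<partial>gibbs F \<gamma>)
        = \<theta>\<^sup>2 * (\<integral>x. (cos (\<theta> * (x \<bullet> e) + \<alpha>))\<^sup>2 \<partial>gibbs F \<gamma>)"
      unfolding norm_grad by simp
    moreover have "exp (- 1) * (\<integral>x. (sin (\<theta> * (x \<bullet> e) + \<alpha>))\<^sup>2 \<partial>gibbs F \<gamma>) \<le> G.variance ?f"
      using gibbs_variance_sin[OF assms(1) \<open>\<theta> \<noteq> 0\<close> e gibbs_normalized(1)[OF mass], of \<alpha> "G.expectation ?f - 2"]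
      unfolding rate by (simp add: algebra_simps)
    ultimately show ?thesis by simp
  qed
  let ?s = "\<integral>x. (sin (\<theta> * (x \<bullet> e)))\<^sup>2 \<partial>gibbs F \<gamma>" and ?c = "\<integral>x. (cos (\<theta> * (x \<bullet> e)))\<^sup>2 \<partial>gibbs F \<gamma>"
  have int_s: "integrable (gibbs F \<gamma>) (\<lambda>x. (sin (\<theta> * (x \<bullet> e)))\<^sup>2)"
    and int_c: "integrable (gibbs F \<gamma>) (\<lambda>x. (cos (\<theta> * (x \<bullet> e)))\<^sup>2)"
    by (rule G.integrable_const_bound[where B = 1]; auto simp: abs_square_le_1)+
  have "?s + ?c = (\<integral>x. (sin (\<theta> * (x \<bullet> e)))\<^sup>2 + (cos (\<theta> * (x \<bullet> e)))\<^sup>2 \<partial>gibbs F \<gamma>)"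
    by (rule Bochner_Integration.integral_add[OF int_s int_c, symmetric])
  also have "\<dots> = 1"
    by (simp add: G.prob_space)
  finally have total: "?s + ?c = 1" .
  have "exp (- 1) * ?s \<le> 2 / \<beta> * (\<theta>\<^sup>2 * ?c)"
    using key[of 0] by simp
  moreover have "exp (- 1) * ?c \<le> 2 / \<beta> * (\<theta>\<^sup>2 * ?s)"
    using key[of "pi / 2"] by (simp add: sin_add cos_add)
  ultimately have "exp (- 1) * (?s + ?c) \<le> 2 / \<beta> * (\<theta>\<^sup>2 * (?s + ?c))"
    by (simp only: distrib_left)
  then have "exp (- 1) \<le> L * pi\<^sup>2 / (\<gamma> * \<beta>)"
    unfolding total \<theta>_sq by (simp add: mult.commute)
  then have "\<gamma> * \<beta> \<le> exp 1 * (L * pi\<^sup>2)"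
    using assms(1,2) by (simp add: exp_minus field_simps)
  also have "\<dots> \<le> 3 * (L * 12)"
  proof -
    have "pi\<^sup>2 \<le> (16 / 5)\<^sup>2"
      using pi_le_3_2 by (intro power_mono) auto
    then have "pi\<^sup>2 \<le> 12"
      by (simp add: power_divide)
    then show ?thesis
      using exp_le L_pos by (intro mult_mono mult_left_mono) auto
  qed
  finally show ?thesis by (simp add: mult.commute)
qed

end

section \<open>Contraction near a strongly convex minimum\<close>

context lipschitz_gradient
begin

text \<open>The Hessian bound is integrated along the segment from \<open>c\<close> to \<open>x\<close>, which stays in the ball.\<close>

lemma strong_monotone_on_ball:
  assumes "\<And>x. norm (x - c) < r \<Longrightarrow> \<exists>H. (grad F has_derivative H) (at x) \<and> (\<forall>v. m * (norm v)\<^sup>2 \<le> v \<bullet> H v)"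
    and "norm (x - c) < r"
  shows "m * (norm (x - c))\<^sup>2 \<le> (x - c) \<bullet> (grad F x - grad F c)"
proof -
  define v where "v = x - c"
  define \<psi> where "\<psi> t = v \<bullet> grad F (c + t *\<^sub>R v) - m * t * (norm v)\<^sup>2" for t
  have "\<psi> 0 \<le> \<psi> 1"
  proof (rule DERIV_nonneg_imp_nondecreasing[where f = \<psi>])
    fix t :: real assume t: "0 \<le> t" "t \<le> 1"
    have "norm (c + t *\<^sub>R v - c) \<le> norm v"
      using t by (simp add: mult_left_le_one_le)
    then obtain H where H: "(grad F has_derivative H) (at (c + t *\<^sub>R v))"
        "m * (norm v)\<^sup>2 \<le> v \<bullet> H v"
      using assms(1)[of "c + t *\<^sub>R v"] assms(2) unfolding v_def by fastforce
    interpret bounded_linear H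
      using H(1) by (rule has_derivative_bounded_linear)
    have "((\<lambda>t. grad F (c + t *\<^sub>R v)) has_derivative (\<lambda>s. H (s *\<^sub>R v))) (at t)"
      by (rule has_derivative_compose[where f = "\<lambda>t. c + t *\<^sub>R v", OF _ H(1)])
        (auto intro!: derivative_eq_intros)
    then have "((\<lambda>t. v \<bullet> grad F (c + t *\<^sub>R v)) has_derivative (\<lambda>s. v \<bullet> H (s *\<^sub>R v))) (at t)"
      by (rule has_derivative_inner_right)
    moreover have "(\<lambda>s. v \<bullet> H (s *\<^sub>R v)) = (*) (v \<bullet> H v)"
      by (auto simp: scaleR mult.commute)
    ultimately have "((\<lambda>t. v \<bullet> grad F (c + t *\<^sub>R v)) has_real_derivative (v \<bullet> H v)) (at t)"
      by (simp add: has_field_derivative_def)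
    then have "(\<psi> has_real_derivative (v \<bullet> H v - m * (norm v)\<^sup>2)) (at t)"
      unfolding \<psi>_def by (auto intro!: derivative_eq_intros)
    then show "\<exists>y. (\<psi> has_real_derivative y) (at t) \<and> 0 \<le> y"
      using H(2) by (intro exI[of _ "v \<bullet> H v - m * (norm v)\<^sup>2"]) auto
  qed simp
  then show ?thesis
    by (simp add: \<psi>_def v_def inner_diff_right)
qed

end

locale strongly_convex_minimum = lipschitz_gradient F L
  for F :: "'a::euclidean_space \<Rightarrow> real" and L +
  fixes xs :: 'a and r0 :: real
  assumes locally_strongly_convex: "locally_strongly_convex F xs r0"
begin

lemma minimum: "F xs \<le> F x"
  using locally_strongly_convex unfolding locally_strongly_convex_def
  by (cases "x = xs") (auto intro: less_imp_le)

lemma r0_pos: "0 < r0"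
  using locally_strongly_convex by (simp add: locally_strongly_convex_def)

lemma grad_at_minimum: "grad F xs = 0"
  using norm_grad_le[OF minimum, of xs] by simp

text \<open>By the Hessian bound the gradient, which vanishes at \<open>xs\<close>, grows at least linearly with the
  distance to \<open>xs\<close>. Together with the smoothness bounds this makes gap and squared distance
  comparable and yields a Polyak-Lojasiewicz inequality.\<close>

lemma obtain_growth_constant:
  obtains m where "0 < m"
    and "\<And>x. x \<in> sublevel F xs r0 \<Longrightarrow> m * norm (x - xs) \<le> norm (grad F x)"
proof -
  obtain m r where m: "0 < m" and ball: "sublevel F xs r0 \<subseteq> {x. norm (x - xs) < r}"
    and hess: "\<And>x. norm (x - xs) < r \<Longrightarrow>
      \<exists>H. (grad F has_derivative H) (at x) \<and> (\<forall>v. m * (norm v)\<^sup>2 \<le> v \<bullet> H v)"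
    using locally_strongly_convex unfolding locally_strongly_convex_def by (metis (no_types, lifting))
  have "m * norm (x - xs) \<le> norm (grad F x)" if "x \<in> sublevel F xs r0" for x
  proof (cases "x = xs")
    case False
    have "m * (norm (x - xs))\<^sup>2 \<le> (x - xs) \<bullet> (grad F x - grad F xs)"
      using that ball by (intro strong_monotone_on_ball[OF hess]) auto
    also have "\<dots> \<le> norm (x - xs) * norm (grad F x)"
      unfolding grad_at_minimum using norm_cauchy_schwarz by simp
    finally have "norm (x - xs) * (m * norm (x - xs)) \<le> norm (x - xs) * norm (grad F x)"
      by (simp add: power2_eq_square mult.left_commute)
    with False show ?thesis by simp
  qed simp
  with m show ?thesis by (rule that)
qed

lemma gap_le_dist: "F x - F xs \<le> L / 2 * (norm (x - xs))\<^sup>2"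
  using descent[of xs "x - xs"] by (simp add: grad_at_minimum)

lemma obtain_local_linear_rate:
  assumes "0 < h" "h * L \<le> 1"
  obtains \<rho> D where "0 < \<rho>" "\<rho> < 1" "0 < D"
    and "\<And>x. x \<in> sublevel F xs r0 \<Longrightarrow> F (x - h *\<^sub>R grad F x) - F xs \<le> \<rho> * (F x - F xs)"
    and "\<And>x. x \<in> sublevel F xs r0 \<Longrightarrow> (norm (x - xs))\<^sup>2 \<le> D * (F x - F xs)"
proof -
  obtain m where m: "0 < m" and growth: "\<And>x. x \<in> sublevel F xs r0 \<Longrightarrow> m * norm (x - xs) \<le> norm (grad F x)"
    using obtain_growth_constant by blast
  have growth_sq: "m\<^sup>2 * (norm (x - xs))\<^sup>2 \<le> (norm (grad F x))\<^sup>2" if "x \<in> sublevel F xs r0" for x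
    using power_mono[OF growth[OF that], of 2] m by (simp add: power_mult_distrib)
  define \<rho> where "\<rho> = max (1 / 2) (1 - h * m\<^sup>2 / L)"
  have "0 < h * m\<^sup>2 / L"
    using assms m L_pos by simp
  then have "0 < \<rho>" "\<rho> < 1"
    by (auto simp: \<rho>_def)
  moreover have "0 < 2 * L / m\<^sup>2"
    using m L_pos by simp
  moreover have "F (x - h *\<^sub>R grad F x) - F xs \<le> \<rho> * (F x - F xs)" if "x \<in> sublevel F xs r0" for x
  proof -
    have "h * m\<^sup>2 / L * (F x - F xs) \<le> h * m\<^sup>2 / L * (L / 2 * (norm (x - xs))\<^sup>2)"
      using assms m L_pos gap_le_dist by (intro mult_left_mono) auto
    also have "\<dots> = h / 2 * (m\<^sup>2 * (norm (x - xs))\<^sup>2)"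
      using L_pos by simp
    also have "\<dots> \<le> h / 2 * (norm (grad F x))\<^sup>2"
      using growth_sq[OF that] assms by (intro mult_left_mono) auto
    finally have "F (x - h *\<^sub>R grad F x) - F xs \<le> (1 - h * m\<^sup>2 / L) * (F x - F xs)"
      using gradient_step_decrease[OF assms, of x] by (simp add: left_diff_distrib)
    also have "\<dots> \<le> \<rho> * (F x - F xs)"
      using minimum[of x] by (intro mult_right_mono) (auto simp: \<rho>_def)
    finally show ?thesis .
  qed
  moreover have "(norm (x - xs))\<^sup>2 \<le> 2 * L / m\<^sup>2 * (F x - F xs)" if "x \<in> sublevel F xs r0" for x
    using growth_sq[OF that] norm_grad_le[OF minimum, of x] m
    by (simp add: field_simps)
  ultimately show ?thesis by (rule that)
qed

lemma fst_ld_step_le: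
  assumes "0 \<le> t0"
  shows "F (fst (ld_step alg F \<gamma> h t0 z (x, y))) \<le> F (x - h *\<^sub>R grad F x)"
  using assms by (auto simp: ld_step_def Let_def split: variant.split)

lemma fst_iterates_decreasing:
  assumes "0 < h" "h * L \<le> 1" "0 \<le> t0" and "k \<le> n"
  shows "F (fst (iterates alg F \<gamma> h t0 x0 y0 z n)) \<le> F (fst (iterates alg F \<gamma> h t0 x0 y0 z k))"
  using \<open>k \<le> n\<close>
proof (induction n rule: dec_induct)
  case (step n)
  obtain x y where s: "iterates alg F \<gamma> h t0 x0 y0 z n = (x, y)"
    by fastforce
  have "F (fst (iterates alg F \<gamma> h t0 x0 y0 z (Suc n))) \<le> F (x - h *\<^sub>R grad F x)"
    using fst_ld_step_le[OF assms(3)] by (simp add: s)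
  also have "\<dots> \<le> F x"
    using gradient_step_decrease[OF assms(1,2), of x] assms(1)
    by (smt (verit) half_gt_zero mult_nonneg_nonneg zero_le_power2)
  finally show ?case
    using step.IH by (simp add: s)
qed simp

text \<open>Neither variant ever accepts a point worse than the gradient step, so once the first
  component is in the sub-level set it stays there, and its gap decays at least as fast as under plain
  gradient descent, whatever the noise does.\<close>

lemma obtain_convergence_after_entry:
  assumes "0 < h" "h * L \<le> 1" "0 \<le> t0"
  obtains \<rho> D where "0 < \<rho>" "\<rho> < 1" "0 < D"
    and "\<And>alg \<gamma> x0 y0 z n k. fst (iterates alg F \<gamma> h t0 x0 y0 z n) \<in> sublevel F xs r0 \<Longrightarrow>
      norm (fst (iterates alg F \<gamma> h t0 x0 y0 z (n + k)) - xs) \<le> D * \<rho> ^ k"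
proof -
  obtain \<rho> D where \<rho>: "0 < \<rho>" "\<rho> < 1" and "0 < D"
    and contract: "\<And>x. x \<in> sublevel F xs r0 \<Longrightarrow> F (x - h *\<^sub>R grad F x) - F xs \<le> \<rho> * (F x - F xs)"
    and dist: "\<And>x. x \<in> sublevel F xs r0 \<Longrightarrow> (norm (x - xs))\<^sup>2 \<le> D * (F x - F xs)"
    using obtain_local_linear_rate[OF assms(1,2)] by blast
  \<comment> \<open>The gap contracts by \<open>\<rho>\<close>, hence the distance by its square root.\<close>
  have bound: "norm (fst (iterates alg F \<gamma> h t0 x0 y0 z (n + k)) - xs) \<le> sqrt (D * r0) * sqrt \<rho> ^ k"
    if "fst (iterates alg F \<gamma> h t0 x0 y0 z n) \<in> sublevel F xs r0" for alg \<gamma> x0 y0 z n k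
  proof -
    let ?X = "\<lambda>k. fst (iterates alg F \<gamma> h t0 x0 y0 z (n + k))"
    have inside: "?X k \<in> sublevel F xs r0" for k
      using that fst_iterates_decreasing[OF assms, of n "n + k" alg \<gamma> x0 y0 z]
      by (simp add: sublevel_def)
    have gap: "F (?X k) - F xs \<le> r0 * \<rho> ^ k" for k
    proof (induction k)
      case 0
      show ?case using inside[of 0] by (simp add: sublevel_def)
    next
      case (Suc k)
      have "F (?X (Suc k)) - F xs \<le> F (?X k - h *\<^sub>R grad F (?X k)) - F xs"
        using fst_ld_step_le[OF assms(3)] by (metis add_Suc_right diff_right_mono iterates.simps(2) prod.collapse)
      also have "\<dots> \<le> \<rho> * (F (?X k) - F xs)"
        by (rule contract[OF inside])
      also have "\<dots> \<le> \<rho> * (r0 * \<rho> ^ k)"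
        using Suc.IH \<rho> by (intro mult_left_mono) auto
      finally show ?case by (simp add: mult_ac)
    qed
    have "(norm (?X k - xs))\<^sup>2 \<le> D * (r0 * \<rho> ^ k)"
      using dist[OF inside[of k]] gap[of k] \<open>0 < D\<close>
      by (meson less_imp_le mult_left_mono order_trans)
    then have "norm (?X k - xs) \<le> sqrt (D * (r0 * \<rho> ^ k))"
      by (rule real_le_rsqrt)
    then show ?thesis
      by (simp add: real_sqrt_mult real_sqrt_power mult_ac)
  qed
  have "0 < sqrt \<rho>" "sqrt \<rho> < 1" "0 < sqrt (D * r0)"
    using \<rho> \<open>0 < D\<close> r0_pos by auto
  with bound show ?thesis by (intro that)
qed

end

section \<open>Moments and small balls of the Gaussian noise\<close>

abbreviation std_gaussian :: "'a::euclidean_space measure" where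
  "std_gaussian \<equiv> density lborel (\<lambda>z. ennreal (std_gaussian_density z))"

lemma borel_measurable_std_gaussian_density [measurable]:
  "std_gaussian_density \<in> borel_measurable borel"
  unfolding std_gaussian_density_def by measurable

lemma std_gaussian_density_nonneg: "0 \<le> std_gaussian_density z"
  by (simp add: std_gaussian_density_def)

text \<open>Half of the Gaussian exponent dominates \<open>\<parallel>z\<parallel>\<^sup>2\<close>, and the rescaling \<open>z = \<surd>2 w\<close> turns what is left
  into a multiple of the standard density. No Gaussian integral has to be computed: that the standard
  density has mass one is part of the assumption.\<close>

lemma std_gaussian_second_moment_finite:
  assumes "prob_space (std_gaussian :: 'a::euclidean_space measure)"
  shows "(\<integral>\<^sup>+z. ennreal ((norm z)\<^sup>2) \<partial>(std_gaussian :: 'a measure)) < \<infinity>"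
proof -
  define C where "C = (2 * pi) powr (- real DIM('a) / 2)"
  have "0 \<le> C" by (simp add: C_def)
  have dens: "std_gaussian_density z = C * exp (- (norm z)\<^sup>2 / 2)" for z :: 'a
    by (simp add: std_gaussian_density_def C_def)
  have total: "(\<integral>\<^sup>+z. ennreal (std_gaussian_density z) \<partial>(lborel :: 'a measure)) = 1"
    using prob_space.emeasure_space_1[OF assms] by (simp add: emeasure_density)
  let ?\<phi> = "\<lambda>z :: 'a. ennreal (4 * C * exp (- (norm z)\<^sup>2 / 4))"
  have "(\<integral>\<^sup>+z. ennreal ((norm z)\<^sup>2) \<partial>(std_gaussian :: 'a measure))
      = (\<integral>\<^sup>+z. ennreal (std_gaussian_density z) * ennreal ((norm z)\<^sup>2) \<partial>(lborel :: 'a measure))"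
    by (subst nn_integral_density) auto
  also have "\<dots> \<le> (\<integral>\<^sup>+z. ?\<phi> z \<partial>lborel)"
  proof (rule nn_integral_mono)
    fix z :: 'a
    have "(norm z)\<^sup>2 \<le> 4 * exp ((norm z)\<^sup>2 / 4)"
      using exp_ge_add_one_self[of "(norm z)\<^sup>2 / 4"] by linarith
    then have "C * exp (- (norm z)\<^sup>2 / 2) * (norm z)\<^sup>2 \<le> C * exp (- (norm z)\<^sup>2 / 2) * (4 * exp ((norm z)\<^sup>2 / 4))"
      using \<open>0 \<le> C\<close> by (intro mult_left_mono) auto
    also have "\<dots> = 4 * C * exp (- (norm z)\<^sup>2 / 4)"
      by (simp flip: exp_add)
    finally show "ennreal (std_gaussian_density z) * ennreal ((norm z)\<^sup>2) \<le> ?\<phi> z"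
      using \<open>0 \<le> C\<close> by (simp add: dens flip: ennreal_mult)
  qed
  also have "\<dots> = ennreal (sqrt 2 ^ DIM('a)) * (\<integral>\<^sup>+z. ?\<phi> (0 + sqrt 2 *\<^sub>R z) \<partial>lborel)"
    by (subst lborel_affine[where c = "sqrt 2" and t = "0 :: 'a"])
      (simp_all add: nn_integral_density nn_integral_distr nn_integral_cmult)
  also have "(\<lambda>z. ?\<phi> (0 + sqrt 2 *\<^sub>R z)) = (\<lambda>z. 4 * ennreal (std_gaussian_density z))"
    using \<open>0 \<le> C\<close>
    by (auto simp: dens power_mult_distrib mult.assoc simp flip: ennreal_mult ennreal_numeral)
  also have "ennreal (sqrt 2 ^ DIM('a)) * (\<integral>\<^sup>+z. 4 * ennreal (std_gaussian_density z) \<partial>(lborel :: 'a measure))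
      = ennreal (sqrt 2 ^ DIM('a)) * 4"
    by (simp add: nn_integral_cmult total)
  also have "\<dots> < \<infinity>"
    by (simp add: ennreal_mult_less_top)
  finally show ?thesis .
qed

lemma std_gaussian_ball_lower_bound:
  assumes "prob_space (std_gaussian :: 'a::euclidean_space measure)" and "0 < s"
  obtains c where "0 < c" and "\<And>v :: 'a. norm v \<le> B \<Longrightarrow> c \<le> measure std_gaussian (ball v s)"
proof -
  interpret prob_space "std_gaussian :: 'a measure" by fact
  define q where "q = (2 * pi) powr (- real DIM('a) / 2) * exp (- (\<bar>B\<bar> + s)\<^sup>2 / 2)"
  define vol where "vol = unit_ball_vol (real DIM('a)) * s ^ DIM('a)"
  have pos: "0 < q" "0 < vol"
    using assms(2) by (auto simp: q_def vol_def)
  have "q * vol \<le> measure std_gaussian (ball v s)" if "norm v \<le> B" for v :: 'a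
  proof -
    have dens: "ennreal q * indicator (ball v s) z \<le> ennreal (std_gaussian_density z) * indicator (ball v s) z" for z
    proof (cases "z \<in> ball v s")
      case True
      have "norm z \<le> norm v + norm (z - v)"
        by (metis add_diff_cancel_left' diff_add_cancel norm_triangle_ineq)
      with True that have "norm z \<le> \<bar>B\<bar> + s"
        by (auto simp: dist_norm norm_minus_commute)
      then have "(norm z)\<^sup>2 \<le> (\<bar>B\<bar> + s)\<^sup>2"
        by (intro power_mono) auto
      then have "q \<le> std_gaussian_density z"
        unfolding q_def std_gaussian_density_def by (intro mult_left_mono) auto
      with True show ?thesis by (simp add: ennreal_leI)
    qed simp
    have "ennreal (q * vol) = ennreal q * emeasure lborel (ball v s)"
      using pos assms(2) by (simp add: vol_def emeasure_ball ennreal_mult)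
    also have "\<dots> = (\<integral>\<^sup>+z. ennreal q * indicator (ball v s) z \<partial>lborel)"
      by (rule nn_integral_cmult_indicator[symmetric]) simp
    also have "\<dots> \<le> (\<integral>\<^sup>+z. ennreal (std_gaussian_density z) * indicator (ball v s) z \<partial>lborel)"
      by (intro nn_integral_mono dens)
    also have "\<dots> = ennreal (measure std_gaussian (ball v s))"
      by (simp add: emeasure_density flip: emeasure_eq_measure)
    finally show ?thesis
      by (simp add: ennreal_le_iff)
  qed
  with pos show ?thesis
    by (intro that[of "q * vol"]) auto
qed

section \<open>Drift and capture in one step\<close>

text \<open>This is the arithmetic core of a Harris-type argument. A gap \<open>V\<close> drifts to at most
  \<open>V - a V + b\<close> in mean, and from every state with \<open>V \<le> 2 b / a\<close> the process is killed with probability at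
  least \<open>c\<close>. The weight \<open>1 + \<kappa> V\<close> then contracts in one step: for large \<open>V\<close> through the drift, and for
  small \<open>V\<close> through the killing, provided that \<open>\<kappa>\<close> is so small that the growth of \<open>\<kappa> V\<close> costs
  at most half of \<open>c\<close>.\<close>

lemma drift_and_minorization_imp_contraction:
  fixes a b c :: real
  assumes "0 < a" "0 < b" "0 < c" "c \<le> 1"
  obtains \<kappa> \<rho> :: real where "0 < \<kappa>" "0 < \<rho>" "\<rho> < 1"
    and "\<And>V. 0 \<le> V \<Longrightarrow> V \<le> 2 * b / a \<Longrightarrow> (1 - c) + \<kappa> * (V + b) \<le> \<rho> * (1 + \<kappa> * V)"
    and "\<And>V. 2 * b / a < V \<Longrightarrow> 1 + \<kappa> * (V - a * V + b) \<le> \<rho> * (1 + \<kappa> * V)"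
proof -
  define R where "R = 2 * b / a"
  have R: "0 < R" "a * R = 2 * b" using assms by (auto simp: R_def)
  define \<kappa> where "\<kappa> = c / (2 * (R + b))"
  have \<kappa>: "0 < \<kappa>" "\<kappa> * (R + b) = c / 2"
    using assms R by (auto simp: \<kappa>_def field_simps)
  define \<eta> where "\<eta> = \<kappa> * a * R / (2 * (1 + \<kappa> * R))"
  have \<eta>: "0 < \<eta>" using \<kappa> R assms by (simp add: \<eta>_def add_pos_pos)
  define \<rho> where "\<rho> = max (1 - c / 2) (1 - \<eta>)"
  have "0 < \<rho>" "\<rho> < 1" using assms \<eta> by (auto simp: \<rho>_def)
  moreover have "(1 - c) + \<kappa> * (V + b) \<le> \<rho> * (1 + \<kappa> * V)" if "0 \<le> V" "V \<le> R" for V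
  proof -
    have "\<kappa> * (V + b) \<le> \<kappa> * (R + b)"
      using that \<kappa> by (intro mult_left_mono) auto
    moreover have "1 - c / 2 \<le> \<rho>"
      by (simp add: \<rho>_def)
    ultimately have "(1 - c) + \<kappa> * (V + b) \<le> \<rho>"
      unfolding \<kappa>(2) by linarith
    moreover have "\<rho> * 1 \<le> \<rho> * (1 + \<kappa> * V)"
      using \<open>0 < \<rho>\<close> \<kappa> that by (intro mult_left_mono) auto
    ultimately show ?thesis by simp
  qed
  moreover have "1 + \<kappa> * (V - a * V + b) \<le> \<rho> * (1 + \<kappa> * V)" if "R < V" for V
  proof -
    have V: "0 < V" using that R by linarith
    have "\<eta> * (1 + \<kappa> * V) \<le> \<kappa> * a * V / 2"
    proof -
      have "R * (1 + \<kappa> * V) \<le> V * (1 + \<kappa> * R)"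
        using that by (simp add: algebra_simps)
      then have "\<kappa> * a * (R * (1 + \<kappa> * V)) \<le> \<kappa> * a * (V * (1 + \<kappa> * R))"
        using \<kappa> assms by (intro mult_left_mono) auto
      moreover have "0 < 1 + \<kappa> * R"
        using \<kappa> R by (simp add: add_pos_pos)
      ultimately have le: "\<kappa> * a * (R * (1 + \<kappa> * V)) / (1 + \<kappa> * R) \<le> \<kappa> * a * V"
        by (simp add: pos_divide_le_eq mult.assoc)
      have eq: "\<eta> * (1 + \<kappa> * V) = \<kappa> * a * (R * (1 + \<kappa> * V)) / (1 + \<kappa> * R) / 2"
        by (simp add: \<eta>_def mult_ac)
      show ?thesis
        unfolding eq using le by (rule divide_right_mono) simp
    qed
    moreover have "\<kappa> * b \<le> \<kappa> * (a * V / 2)"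
      using that R(2) \<kappa> assms by (intro mult_left_mono) (auto simp: R_def field_simps)
    ultimately have "1 + \<kappa> * (V - a * V + b) \<le> (1 - \<eta>) * (1 + \<kappa> * V)"
      by (simp add: algebra_simps)
    also have "\<dots> \<le> \<rho> * (1 + \<kappa> * V)"
      using \<kappa> V by (intro mult_right_mono) (auto simp: \<rho>_def)
    finally show ?thesis .
  qed
  ultimately show ?thesis
    using \<kappa>(1) unfolding R_def by (intro that[of \<kappa> \<rho>]) auto
qed

context strongly_convex_minimum
begin

text \<open>In GDxLD a swap turns the gradient step of the first component into the second component, and
  its value is at most the initial one, \<open>F x0\<close>; otherwise
  the second component is the noisy point. A swap can therefore raise the gap of the second component only to a level
  fixed in advance, and the drift survives exchanges without any count of how often they occur.\<close>

lemma snd_ld_step_gap_le: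
  assumes "0 < h" "h * L \<le> 1" "0 < \<gamma>" and "F x \<le> F x0"
  shows "F (snd (ld_step alg F \<gamma> h t0 z (x, y))) - F xs
    \<le> (F y - F xs - h / 4 * (norm (grad F y))\<^sup>2 + (F x0 - F xs)) + (1 / h + L / 2) * (2 * \<gamma> * h) * (norm z)\<^sup>2"
proof -
  let ?x' = "x - h *\<^sub>R grad F x" and ?y' = "y - h *\<^sub>R grad F y + sqrt (2 * \<gamma> * h) *\<^sub>R z"
  define G where "G = h / 4 * (norm (grad F y))\<^sup>2"
  define N where "N = (1 / h + L / 2) * (2 * \<gamma> * h) * (norm z)\<^sup>2"
  have y': "F ?y' \<le> F y - G + N"
    using noisy_gradient_step[OF assms(1,2), of y "sqrt (2 * \<gamma> * h) *\<^sub>R z"] assms(1,3)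
    by (simp add: power_mult_distrib G_def N_def)
  have "0 \<le> h / 2 * (norm (grad F x))\<^sup>2"
    using assms(1) by simp
  then have x': "F ?x' \<le> F x0"
    using gradient_step_decrease[OF assms(1,2), of x] assms(4) by linarith
  have "G \<le> h / 4 * (2 * L * (F y - F xs))"
    unfolding G_def using norm_grad_le[OF minimum, of y] assms(1) by (intro mult_left_mono) auto
  also have "\<dots> = (h * L) * ((F y - F xs) / 2)"
    by simp
  also have "\<dots> \<le> 1 * ((F y - F xs) / 2)"
    using assms(2) minimum[of y] by (intro mult_right_mono) auto
  finally have "0 \<le> F y - F xs - G"
    using minimum[of y] by simp
  moreover have "0 \<le> N"
    using assms L_pos by (simp add: N_def)
  moreover have "F (snd (ld_step alg F \<gamma> h t0 z (x, y))) = F ?x' \<or> F (snd (ld_step alg F \<gamma> h t0 z (x, y))) = F ?y'"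
    by (auto simp: ld_step_def Let_def split: variant.split)
  ultimately show ?thesis
    using x' y' minimum[of x0] unfolding G_def[symmetric] N_def[symmetric] by linarith
qed

text \<open>If the gradient step of \<open>x\<close> is still outside the sub-level set, the noisy point is better by more than
  \<open>3 r0 / 4\<close>, which exceeds the threshold, and it is accepted. If the gradient step is already inside, either
  outcome is at most as large.\<close>

lemma ld_step_captures:
  assumes "t0 < 3 * r0 / 4"
    and "F (y - h *\<^sub>R grad F y + sqrt (2 * \<gamma> * h) *\<^sub>R z) \<le> F xs + r0 / 4"
  shows "fst (ld_step alg F \<gamma> h t0 z (x, y)) \<in> sublevel F xs r0"
  using assms r0_pos by (auto simp: ld_step_def Let_def sublevel_def split: variant.split)

text \<open>The Lyapunov function of the second component, killed when the first component enters the
  sub-level set. Its expectation bounds the probability that no entry has occurred yet.\<close>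

definition escape_weight :: "real \<Rightarrow> 'a \<times> 'a \<Rightarrow> ennreal" where
  "escape_weight \<kappa> s = (if fst s \<in> sublevel F xs r0 then 0 else ennreal (1 + \<kappa> * (F (snd s) - F xs)))"

lemma borel_measurable_escape_weight [measurable]:
  "escape_weight \<kappa> \<in> borel_measurable (borel \<Otimes>\<^sub>M borel)"
  unfolding escape_weight_def sublevel_def by measurable

lemma measurable_ld_step [measurable]:
  "(\<lambda>p. ld_step alg F \<gamma> h t0 (snd p) (fst p)) \<in> (borel \<Otimes>\<^sub>M borel) \<Otimes>\<^sub>M borel \<rightarrow>\<^sub>M borel \<Otimes>\<^sub>M borel"
  unfolding ld_step_def Let_def case_prod_beta by (cases alg; simp only: variant.case; measurable)

lemma bounded_sublevel:
  assumes "filterlim F at_top at_infinity"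
  obtains B where "0 < B" and "\<And>y. F y \<le> c \<Longrightarrow> norm y \<le> B"
proof -
  have "\<forall>\<^sub>F y in at_infinity. c < F y"
    using assms by (simp add: filterlim_at_top_dense)
  then obtain b where b: "\<And>y. b \<le> norm y \<Longrightarrow> c < F y"
    unfolding eventually_at_infinity by blast
  have "norm y \<le> max 1 b" if "F y \<le> c" for y
    using b[of y] that by linarith
  then show ?thesis
    by (intro that[of "max 1 b"]) auto
qed

text \<open>The states of gap at most \<open>R\<close> form a bounded set, so one Gaussian step takes each of them close to
  \<open>xs\<close> with a probability that is bounded away from zero.\<close>

lemma obtain_capture_probability:
  assumes "0 < h" "0 < \<gamma>" and "filterlim F at_top at_infinity"
    and "prob_space (std_gaussian :: 'a measure)"
  obtains c where "0 < c" "c \<le> 1"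
    and "\<And>y. F y - F xs \<le> R \<Longrightarrow> c \<le> measure std_gaussian
      {z. F (y - h *\<^sub>R grad F y + sqrt (2 * \<gamma> * h) *\<^sub>R z) \<le> F xs + r0 / 4}"
proof -
  interpret prob_space "std_gaussian :: 'a measure" by fact
  define \<sigma> where "\<sigma> = sqrt (2 * \<gamma> * h)"
  have \<sigma>: "0 < \<sigma>" using assms(1,2) by (simp add: \<sigma>_def)
  obtain B where B: "\<And>y. F y \<le> F xs + R \<Longrightarrow> norm y \<le> B"
    using bounded_sublevel[OF assms(3)] by blast
  have "isCont F xs"
    using differentiable differentiable_imp_continuous_within by blast
  then obtain s where s: "0 < s" "\<And>y. dist y xs < s \<Longrightarrow> dist (F y) (F xs) < r0 / 4"
    using r0_pos unfolding continuous_at_eps_delta by (metis divide_pos_pos zero_less_numeral)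
  obtain c where c: "0 < c" "\<And>v :: 'a. norm v \<le> (norm xs + (B + h * (L * (B + norm xs)))) / \<sigma> \<Longrightarrow>
      c \<le> measure std_gaussian (ball v (s / \<sigma>))"
    using std_gaussian_ball_lower_bound[OF assms(4), of "s / \<sigma>"] s(1) \<sigma> by (metis divide_pos_pos)
  have "min c 1 \<le> measure std_gaussian {z. F (y - h *\<^sub>R grad F y + \<sigma> *\<^sub>R z) \<le> F xs + r0 / 4}"
    if "F y - F xs \<le> R" for y
  proof -
    define v where "v = (1 / \<sigma>) *\<^sub>R (xs - (y - h *\<^sub>R grad F y))"
    have "norm y \<le> B" using that by (intro B) simp
    have "norm (grad F y) \<le> L * norm (y - xs)"
      using grad_lipschitz[of y xs] by (simp add: grad_at_minimum)
    also have "\<dots> \<le> L * (B + norm xs)"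
      using \<open>norm y \<le> B\<close> norm_triangle_ineq4[of y xs] L_pos by (intro mult_left_mono) auto
    finally have "h * norm (grad F y) \<le> h * (L * (B + norm xs))"
      using assms(1) by (intro mult_left_mono) auto
    moreover have "norm (y - h *\<^sub>R grad F y) \<le> norm y + h * norm (grad F y)"
      using norm_triangle_ineq4[of y "h *\<^sub>R grad F y"] assms(1) by simp
    moreover have "norm (xs - (y - h *\<^sub>R grad F y)) \<le> norm xs + norm (y - h *\<^sub>R grad F y)"
      by (rule norm_triangle_ineq4)
    ultimately have "norm (xs - (y - h *\<^sub>R grad F y)) \<le> norm xs + (B + h * (L * (B + norm xs)))"
      using \<open>norm y \<le> B\<close> by linarith
    then have "norm v \<le> (norm xs + (B + h * (L * (B + norm xs)))) / \<sigma>"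
      using \<sigma> by (simp add: v_def divide_right_mono)
    then have "c \<le> measure std_gaussian (ball v (s / \<sigma>))"
      by (rule c(2))
    also have "\<dots> \<le> measure std_gaussian {z. F (y - h *\<^sub>R grad F y + \<sigma> *\<^sub>R z) \<le> F xs + r0 / 4}"
    proof (rule finite_measure_mono)
      show "ball v (s / \<sigma>) \<subseteq> {z. F (y - h *\<^sub>R grad F y + \<sigma> *\<^sub>R z) \<le> F xs + r0 / 4}"
      proof
        fix z assume z: "z \<in> ball v (s / \<sigma>)"
        have "y - h *\<^sub>R grad F y + \<sigma> *\<^sub>R z - xs = \<sigma> *\<^sub>R (z - v)"
          using \<sigma> by (simp add: v_def scaleR_diff_right)
        then have "dist (y - h *\<^sub>R grad F y + \<sigma> *\<^sub>R z) xs = \<sigma> * dist z v"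
          using \<sigma> by (simp add: dist_norm)
        also have "\<dots> < s"
          using z \<sigma> by (simp add: dist_commute field_simps)
        finally have "dist (F (y - h *\<^sub>R grad F y + \<sigma> *\<^sub>R z)) (F xs) < r0 / 4"
          by (rule s(2))
        then show "z \<in> {z. F (y - h *\<^sub>R grad F y + \<sigma> *\<^sub>R z) \<le> F xs + r0 / 4}"
          unfolding dist_real_def mem_Collect_eq by linarith
      qed
      show "{z. F (y - h *\<^sub>R grad F y + \<sigma> *\<^sub>R z) \<le> F xs + r0 / 4} \<in> sets std_gaussian"
        by simp
    qed
    finally show ?thesis by simp
  qed
  then show ?thesis
    using c(1) by (intro that[of "min c 1"]) (auto simp: \<sigma>_def)
qed

text \<open>Drift and capture probability feed the contraction lemma. The drift has rate \<open>h lam_c / 4\<close>, because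
  coercivity bounds the squared gradient from below by a multiple of \<open>F\<close>.\<close>

lemma obtain_escape_contraction:
  assumes "0 < h" "h * L \<le> 1" "0 < \<gamma>" "0 \<le> t0" "t0 < 3 * r0 / 4"
    and coercive: "coercive F lam_c M_c"
    and "prob_space (std_gaussian :: 'a measure)"
  obtains \<kappa> \<rho> :: real where "0 < \<kappa>" "0 < \<rho>" "\<rho> < 1"
    and "\<And>alg x y. F x \<le> F x0 \<Longrightarrow>
      (\<integral>\<^sup>+z. escape_weight \<kappa> (ld_step alg F \<gamma> h t0 z (x, y)) \<partial>std_gaussian) \<le> ennreal \<rho> * escape_weight \<kappa> (x, y)"
proof -
  interpret G: prob_space "std_gaussian :: 'a measure" by fact
  obtain s2 where s2: "0 \<le> s2" "(\<integral>\<^sup>+z. ennreal ((norm z)\<^sup>2) \<partial>(std_gaussian :: 'a measure)) = ennreal s2"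
    using std_gaussian_second_moment_finite[OF assms(7)] by (cases rule: ennreal_cases) auto
  have lam: "0 < lam_c" "\<And>x. lam_c * F x - M_c \<le> (norm (grad F x))\<^sup>2" and lim: "filterlim F at_top at_infinity"
    using coercive by (auto simp: coercive_def)
  define E where "E = F x0 - F xs"
  define c3 where "c3 = (1 / h + L / 2) * (2 * \<gamma> * h)"
  define b0 where "b0 = h / 4 * \<bar>M_c - lam_c * F xs\<bar>"
  define a where "a = h / 4 * lam_c"
  define b where "b = b0 + E + c3 * s2 + 1"
  have nonneg: "0 \<le> E" "0 \<le> c3" "0 \<le> b0" "0 \<le> c3 * s2" "0 < a"
    using assms lam minimum[of x0] L_pos s2 by (auto simp: E_def c3_def b0_def a_def)
  then have "0 < b" by (simp add: b_def)
  obtain c where c: "0 < c" "c \<le> 1" "\<And>y. F y - F xs \<le> 2 * b / a \<Longrightarrow> c \<le> measure std_gaussian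
      {z. F (y - h *\<^sub>R grad F y + sqrt (2 * \<gamma> * h) *\<^sub>R z) \<le> F xs + r0 / 4}"
    using obtain_capture_probability[OF assms(1,3) lim assms(7)] by blast
  obtain \<kappa> \<rho> where \<kappa>: "0 < \<kappa>" and \<rho>: "0 < \<rho>" "\<rho> < 1"
    and small: "\<And>V. 0 \<le> V \<Longrightarrow> V \<le> 2 * b / a \<Longrightarrow> (1 - c) + \<kappa> * (V + b) \<le> \<rho> * (1 + \<kappa> * V)"
    and large: "\<And>V. 2 * b / a < V \<Longrightarrow> 1 + \<kappa> * (V - a * V + b) \<le> \<rho> * (1 + \<kappa> * V)"
    using drift_and_minorization_imp_contraction[OF \<open>0 < a\<close> \<open>0 < b\<close> c(1,2)] by blast
  have "(\<integral>\<^sup>+z. escape_weight \<kappa> (ld_step alg F \<gamma> h t0 z (x, y)) \<partial>std_gaussian) \<le> ennreal \<rho> * escape_weight \<kappa> (x, y)"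
    if x: "F x \<le> F x0" for alg x y
  proof (cases "x \<in> sublevel F xs r0")
    case True
    have "fst (ld_step alg F \<gamma> h t0 z (x, y)) \<in> sublevel F xs r0" for z
    proof -
      have "0 \<le> h / 2 * (norm (grad F x))\<^sup>2"
        using assms(1) by simp
      then show ?thesis
        using True fst_ld_step_le[OF assms(4), of alg \<gamma> h z x y] gradient_step_decrease[OF assms(1,2), of x]
        unfolding sublevel_def mem_Collect_eq by linarith
    qed
    then show ?thesis by (simp add: escape_weight_def)
  next
    case False
    define V where "V = F y - F xs"
    define e where "e = V - h / 4 * (norm (grad F y))\<^sup>2 + E"
    define A where "A = {z. F (y - h *\<^sub>R grad F y + sqrt (2 * \<gamma> * h) *\<^sub>R z) \<le> F xs + r0 / 4}"
    have "0 \<le> V" using minimum[of y] by (simp add: V_def)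
    have A_sets [measurable]: "A \<in> sets borel"
      unfolding A_def by simp
    have next_gap: "F (snd (ld_step alg F \<gamma> h t0 z (x, y))) - F xs \<le> e + c3 * (norm z)\<^sup>2" for z
      using snd_ld_step_gap_le[OF assms(1,2,3) x] by (simp add: e_def V_def E_def c3_def)
    have "0 \<le> e"
      using order_trans[OF _ next_gap[of 0]] minimum[of "snd (ld_step alg F \<gamma> h t0 0 (x, y))"] by simp
    \<comment> \<open>\<open>A\<close> collects the noise vectors that bring the noisy point near \<open>xs\<close> and so force an entry.\<close>
    have pointwise: "escape_weight \<kappa> (ld_step alg F \<gamma> h t0 z (x, y))
        \<le> indicator (- A) z + (ennreal (\<kappa> * e) + ennreal (\<kappa> * c3) * ennreal ((norm z)\<^sup>2))" for z
    proof (cases "fst (ld_step alg F \<gamma> h t0 z (x, y)) \<in> sublevel F xs r0")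
      case False
      then have "z \<in> - A"
        using ld_step_captures[OF assms(5)] by (auto simp: A_def)
      have "1 + \<kappa> * (F (snd (ld_step alg F \<gamma> h t0 z (x, y))) - F xs) \<le> 1 + \<kappa> * (e + c3 * (norm z)\<^sup>2)"
        using next_gap \<kappa> by (intro add_left_mono mult_left_mono) auto
      also have "\<dots> = 1 + (\<kappa> * e + \<kappa> * c3 * (norm z)\<^sup>2)"
        by (simp add: distrib_left)
      finally have "ennreal (1 + \<kappa> * (F (snd (ld_step alg F \<gamma> h t0 z (x, y))) - F xs))
          \<le> 1 + (ennreal (\<kappa> * e) + ennreal (\<kappa> * c3) * ennreal ((norm z)\<^sup>2))"
        using \<kappa> \<open>0 \<le> e\<close> nonneg(2) by (simp add: ennreal_leI flip: ennreal_plus ennreal_mult ennreal_1)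
      with False \<open>z \<in> - A\<close> show ?thesis by (simp add: escape_weight_def)
    qed (simp add: escape_weight_def)
    have "(\<integral>\<^sup>+z. escape_weight \<kappa> (ld_step alg F \<gamma> h t0 z (x, y)) \<partial>std_gaussian)
        \<le> (\<integral>\<^sup>+z. indicator (- A) z + (ennreal (\<kappa> * e) + ennreal (\<kappa> * c3) * ennreal ((norm z)\<^sup>2)) \<partial>std_gaussian)"
      by (intro nn_integral_mono pointwise)
    also have "\<dots> = emeasure std_gaussian (- A) + (ennreal (\<kappa> * e) + ennreal (\<kappa> * c3) * ennreal s2)"
      using G.emeasure_space_1 by (simp add: nn_integral_add nn_integral_cmult s2(2))
    also have "emeasure std_gaussian (- A) = ennreal (1 - measure std_gaussian A)"
      using G.prob_compl[of A] by (simp add: G.emeasure_eq_measure Compl_eq_Diff_UNIV)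
    also have "\<dots> + (ennreal (\<kappa> * e) + ennreal (\<kappa> * c3) * ennreal s2)
        = ennreal ((1 - measure std_gaussian A) + \<kappa> * (e + c3 * s2))"
      using \<kappa> \<open>0 \<le> e\<close> nonneg s2(1) G.prob_le_1[of A]
      by (simp add: distrib_left mult.assoc flip: ennreal_plus ennreal_mult)
    also have "\<dots> \<le> ennreal (\<rho> * (1 + \<kappa> * V))"
    proof (rule ennreal_leI, cases "V \<le> 2 * b / a")
      case True
      have "0 \<le> h / 4 * (norm (grad F y))\<^sup>2"
        using assms(1) by simp
      then have "e + c3 * s2 \<le> V + b"
        using nonneg by (simp add: e_def b_def)
      then have "\<kappa> * (e + c3 * s2) \<le> \<kappa> * (V + b)"
        using \<kappa> by (intro mult_left_mono) auto
      moreover have "c \<le> measure std_gaussian A"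
        using c(3)[of y] True by (simp add: V_def A_def)
      ultimately show "(1 - measure std_gaussian A) + \<kappa> * (e + c3 * s2) \<le> \<rho> * (1 + \<kappa> * V)"
        using small[OF \<open>0 \<le> V\<close> True] by linarith
    next
      case False
      have "h / 4 * (lam_c * F y - M_c) \<le> h / 4 * (norm (grad F y))\<^sup>2"
        using lam(2) assms(1) by (intro mult_left_mono) auto
      moreover have "h / 4 * (M_c - lam_c * F xs) \<le> b0"
        unfolding b0_def using assms(1) by (intro mult_left_mono) auto
      moreover have "h / 4 * (lam_c * F y - M_c) = a * V - h / 4 * (M_c - lam_c * F xs)"
        by (simp only: a_def V_def right_diff_distrib mult.assoc)
      ultimately have "e + c3 * s2 \<le> V - a * V + b"
        using nonneg unfolding e_def b_def by linarith
      then have "\<kappa> * (e + c3 * s2) \<le> \<kappa> * (V - a * V + b)"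
        using \<kappa> by (intro mult_left_mono) auto
      moreover have "0 \<le> measure std_gaussian A"
        by simp
      ultimately show "(1 - measure std_gaussian A) + \<kappa> * (e + c3 * s2) \<le> \<rho> * (1 + \<kappa> * V)"
        using large[of V] False by linarith
    qed
    also have "\<dots> = ennreal \<rho> * escape_weight \<kappa> (x, y)"
      using False \<rho> by (simp add: escape_weight_def V_def ennreal_mult')
    finally show ?thesis .
  qed
  with \<kappa> \<rho> show ?thesis by (intro that[of \<kappa> \<rho>]) auto
qed

end

section \<open>Geometric tails of the entry time\<close>

lemma iterates_cong:
  "(\<And>k. k < n \<Longrightarrow> z k = z' k) \<Longrightarrow> iterates alg F \<gamma> h t0 x0 y0 z n = iterates alg F \<gamma> h t0 x0 y0 z' n"
  by (induction n) auto

context strongly_convex_minimum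
begin

lemma measurable_iterates:
  "n \<le> m \<Longrightarrow> (\<lambda>z. iterates alg F \<gamma> h t0 x0 y0 z n) \<in> (\<Pi>\<^sub>M k\<in>{..<m}. borel) \<rightarrow>\<^sub>M borel \<Otimes>\<^sub>M borel"
proof (induction n)
  case (Suc n)
  then have [measurable]: "(\<lambda>z. iterates alg F \<gamma> h t0 x0 y0 z n) \<in> (\<Pi>\<^sub>M k\<in>{..<m}. borel) \<rightarrow>\<^sub>M borel \<Otimes>\<^sub>M borel"
    by simp
  have [measurable]: "(\<lambda>z. z n) \<in> (\<Pi>\<^sub>M k\<in>{..<m}. borel) \<rightarrow>\<^sub>M (borel :: 'a measure)"
    using Suc.prems by (intro measurable_component_singleton) auto
  have "(\<lambda>z. (iterates alg F \<gamma> h t0 x0 y0 z n, z n)) \<in> (\<Pi>\<^sub>M k\<in>{..<m}. borel) \<rightarrow>\<^sub>M (borel \<Otimes>\<^sub>M borel) \<Otimes>\<^sub>M borel"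
    by measurable
  from measurable_compose[OF this measurable_ld_step] show ?case
    by simp
qed simp

text \<open>The Markov property: the state at time \<open>n\<close> is a function of the noise before \<open>n\<close>, which is independent
  of the noise at time \<open>n\<close>.\<close>

lemma nn_integral_next_iterate:
  fixes Z :: "nat \<Rightarrow> 'w \<Rightarrow> 'a" and alg and \<gamma> h t0 :: real and x0 y0 :: 'a
  assumes "prob_space P" "iid_std_gaussian P Z"
    and [measurable]: "f \<in> borel_measurable (borel \<Otimes>\<^sub>M borel)"
  defines "S \<equiv> \<lambda>n \<omega>. iterates alg F \<gamma> h t0 x0 y0 (\<lambda>k. Z k \<omega>) n"
  shows "(\<integral>\<^sup>+\<omega>. f (S (Suc n) \<omega>) \<partial>P) = (\<integral>\<^sup>+\<omega>. \<integral>\<^sup>+z. f (ld_step alg F \<gamma> h t0 z (S n \<omega>)) \<partial>std_gaussian \<partial>P)"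
    and "S n \<in> P \<rightarrow>\<^sub>M borel \<Otimes>\<^sub>M borel"
proof -
  interpret prob_space P by fact
  have indep: "indep_vars (\<lambda>_. borel) Z UNIV" and law: "distributed P lborel (Z n) (\<lambda>z. ennreal (std_gaussian_density z))"
    using assms(2) by (auto simp: iid_std_gaussian_def)
  have Z_meas [measurable]: "Z n \<in> P \<rightarrow>\<^sub>M borel"
    using law by (simp add: distributed_def)
  have "distr P borel (Z n) = distr P lborel (Z n)"
    by (rule distr_cong) auto
  also have "\<dots> = std_gaussian"
    using law by (rule distributed_distr_eq_density)
  finally have Z_law: "distr P borel (Z n) = std_gaussian" .
  let ?past = "\<lambda>\<omega>. restrict (\<lambda>i. Z i \<omega>) {..<n}" and ?now = "\<lambda>\<omega>. restrict (\<lambda>i. Z i \<omega>) {n}"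
  let ?M = "\<Pi>\<^sub>M k\<in>{..<n}. (borel :: 'a measure)" and ?N = "\<Pi>\<^sub>M k\<in>{n}. (borel :: 'a measure)"
  define T where "T z = iterates alg F \<gamma> h t0 x0 y0 z n" for z
  have T_past: "T (?past \<omega>) = S n \<omega>" for \<omega>
    unfolding S_def T_def by (rule iterates_cong) simp
  have "indep_var ?M ?past ?N ?now"
    using indep by (rule indep_var_restrict) auto
  then have past_meas [measurable]: "?past \<in> P \<rightarrow>\<^sub>M ?M" and now_meas [measurable]: "?now \<in> P \<rightarrow>\<^sub>M ?N"
    and joint: "distr P ?M ?past \<Otimes>\<^sub>M distr P ?N ?now = distr P (?M \<Otimes>\<^sub>M ?N) (\<lambda>\<omega>. (?past \<omega>, ?now \<omega>))"
    unfolding indep_var_distribution_eq by blast+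
  have T_meas [measurable]: "T \<in> ?M \<rightarrow>\<^sub>M borel \<Otimes>\<^sub>M borel"
    unfolding T_def by (rule measurable_iterates) simp
  show "S n \<in> P \<rightarrow>\<^sub>M borel \<Otimes>\<^sub>M borel"
    using measurable_compose[OF past_meas T_meas] by (simp add: T_past)
  interpret N: prob_space "distr P ?N ?now"
    by (rule prob_space_distr) (rule now_meas)
  note change_of_variables = nn_integral_distr[unfolded measurable_distr_eq1]
  let ?g = "\<lambda>p. f (ld_step alg F \<gamma> h t0 (snd p) (fst p))"
  have g_meas: "?g \<in> borel_measurable ((borel \<Otimes>\<^sub>M borel) \<Otimes>\<^sub>M borel)"
    using measurable_compose[OF measurable_ld_step assms(3)] .
  have coord_meas [measurable]: "(\<lambda>q. q n) \<in> ?N \<rightarrow>\<^sub>M borel"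
    by (rule measurable_component_singleton) simp
  let ?k = "\<lambda>p. ?g (T (fst p), snd p n)"
  have "(\<lambda>p. (T (fst p), snd p n)) \<in> ?M \<Otimes>\<^sub>M ?N \<rightarrow>\<^sub>M (borel \<Otimes>\<^sub>M borel) \<Otimes>\<^sub>M borel"
    by measurable
  from measurable_compose[OF this g_meas] have k_meas: "?k \<in> borel_measurable (?M \<Otimes>\<^sub>M ?N)" .
  then have k_meas_distr: "?k \<in> borel_measurable (?M \<Otimes>\<^sub>M distr P ?N ?now)"
    by (simp cong: measurable_cong_sets sets_pair_measure_cong)
  have "(\<integral>\<^sup>+\<omega>. f (S (Suc n) \<omega>) \<partial>P) = (\<integral>\<^sup>+\<omega>. ?k (?past \<omega>, ?now \<omega>) \<partial>P)"
    by (simp add: T_past) (simp add: S_def)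
  also have "\<dots> = (\<integral>\<^sup>+p. ?k p \<partial>distr P (?M \<Otimes>\<^sub>M ?N) (\<lambda>\<omega>. (?past \<omega>, ?now \<omega>)))"
    by (rule change_of_variables[symmetric, OF _ k_meas]) measurable
  also have "\<dots> = (\<integral>\<^sup>+p. ?k p \<partial>(distr P ?M ?past \<Otimes>\<^sub>M distr P ?N ?now))"
    by (simp only: joint)
  also have "\<dots> = (\<integral>\<^sup>+p. \<integral>\<^sup>+q. ?k (p, q) \<partial>distr P ?N ?now \<partial>distr P ?M ?past)"
  proof (rule N.nn_integral_fst[symmetric])
    show "?k \<in> borel_measurable (distr P ?M ?past \<Otimes>\<^sub>M distr P ?N ?now)"
      using k_meas by (simp cong: measurable_cong_sets sets_pair_measure_cong)
  qed
  also have "\<dots> = (\<integral>\<^sup>+\<omega>. \<integral>\<^sup>+q. ?k (?past \<omega>, q) \<partial>distr P ?N ?now \<partial>P)"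
    by (rule change_of_variables[OF past_meas]) (rule N.borel_measurable_nn_integral_fst[OF k_meas_distr])
  also have "\<dots> = (\<integral>\<^sup>+\<omega>. \<integral>\<^sup>+z. f (ld_step alg F \<gamma> h t0 z (S n \<omega>)) \<partial>std_gaussian \<partial>P)"
  proof (rule nn_integral_cong)
    fix \<omega>
    have slice: "(\<lambda>z. ?g (S n \<omega>, z)) \<in> borel_measurable borel"
      by (rule measurable_compose[OF measurable_Pair1' g_meas]) (simp add: space_pair_measure)
    have "(\<integral>\<^sup>+q. ?k (?past \<omega>, q) \<partial>distr P ?N ?now) = (\<integral>\<^sup>+q. ?g (S n \<omega>, q n) \<partial>distr P ?N ?now)"
      by (simp only: fst_conv snd_conv T_past)
    also have "\<dots> = (\<integral>\<^sup>+\<omega>'. ?g (S n \<omega>, ?now \<omega>' n) \<partial>P)"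
      by (rule change_of_variables[OF now_meas]) (rule measurable_compose[OF coord_meas slice])
    also have "\<dots> = (\<integral>\<^sup>+\<omega>'. ?g (S n \<omega>, Z n \<omega>') \<partial>P)"
      by simp
    also have "\<dots> = (\<integral>\<^sup>+z. ?g (S n \<omega>, z) \<partial>distr P borel (Z n))"
      by (rule change_of_variables[OF Z_meas slice, symmetric])
    finally show "(\<integral>\<^sup>+q. ?k (?past \<omega>, q) \<partial>distr P ?N ?now)
        = (\<integral>\<^sup>+z. f (ld_step alg F \<gamma> h t0 z (S n \<omega>)) \<partial>std_gaussian)"
      unfolding Z_law by simp
  qed
  finally show "(\<integral>\<^sup>+\<omega>. f (S (Suc n) \<omega>) \<partial>P)
      = (\<integral>\<^sup>+\<omega>. \<integral>\<^sup>+z. f (ld_step alg F \<gamma> h t0 z (S n \<omega>)) \<partial>std_gaussian \<partial>P)" .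
qed

lemma obtain_geometric_escape:
  fixes Z :: "nat \<Rightarrow> 'w \<Rightarrow> 'a"
  assumes "0 < h" "h * L \<le> 1" "0 < \<gamma>" "0 \<le> t0" "t0 < 3 * r0 / 4"
    and "coercive F lam_c M_c"
    and "prob_space P" "iid_std_gaussian P Z"
  obtains D \<rho> :: real where "0 < D" "0 < \<rho>" "\<rho> < 1"
    and "\<And>n. measure P {\<omega> \<in> space P. fst (iterates alg F \<gamma> h t0 x0 y0 (\<lambda>k. Z k \<omega>) n) \<notin> sublevel F xs r0} \<le> D * \<rho> ^ n"
proof -
  interpret prob_space P by fact
  define S where "S n \<omega> = iterates alg F \<gamma> h t0 x0 y0 (\<lambda>k. Z k \<omega>) n" for n \<omega>
  note next_iterate = nn_integral_next_iterate[OF assms(7,8), where alg = alg and \<gamma> = \<gamma> and h = h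
      and ?t0.0 = t0 and ?x0.0 = x0 and ?y0.0 = y0, folded S_def]
  have "prob_space (std_gaussian :: 'a measure)"
    using prob_space_distr[of "Z 0" lborel] assms(8) distributed_distr_eq_density[of P lborel "Z 0"]
    by (fastforce simp: iid_std_gaussian_def distributed_def)
  then obtain \<kappa> \<rho> where \<kappa>: "0 < \<kappa>" and \<rho>: "0 < \<rho>" "\<rho> < 1"
    and contract: "\<And>x y. F x \<le> F x0 \<Longrightarrow>
      (\<integral>\<^sup>+z. escape_weight \<kappa> (ld_step alg F \<gamma> h t0 z (x, y)) \<partial>std_gaussian) \<le> ennreal \<rho> * escape_weight \<kappa> (x, y)"
    using obtain_escape_contraction[OF assms(1-6)] by metis
  have S_meas [measurable]: "S n \<in> P \<rightarrow>\<^sub>M borel \<Otimes>\<^sub>M borel" for n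
    by (rule next_iterate(2)) (rule borel_measurable_const)
  define D where "D = 1 + \<kappa> * (F y0 - F xs)"
  have "0 < D"
    using \<kappa> minimum[of y0] by (simp add: D_def add_pos_nonneg)
  have expected: "(\<integral>\<^sup>+\<omega>. escape_weight \<kappa> (S n \<omega>) \<partial>P) \<le> ennreal (D * \<rho> ^ n)" for n
  proof (induction n)
    case 0
    have "escape_weight \<kappa> (x0, y0) \<le> ennreal D"
      using \<open>0 < D\<close> by (simp add: escape_weight_def D_def)
    then show ?case by (simp add: S_def emeasure_space_1)
  next
    case (Suc n)
    have "F (fst (S n \<omega>)) \<le> F x0" for \<omega>
      using fst_iterates_decreasing[OF assms(1,2,4), of 0 n alg \<gamma> x0 y0] by (simp add: S_def)
    then have "(\<integral>\<^sup>+z. escape_weight \<kappa> (ld_step alg F \<gamma> h t0 z (S n \<omega>)) \<partial>std_gaussian)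
        \<le> ennreal \<rho> * escape_weight \<kappa> (S n \<omega>)" for \<omega>
      using contract[of "fst (S n \<omega>)" "snd (S n \<omega>)"] by simp
    then have "(\<integral>\<^sup>+\<omega>. escape_weight \<kappa> (S (Suc n) \<omega>) \<partial>P) \<le> (\<integral>\<^sup>+\<omega>. ennreal \<rho> * escape_weight \<kappa> (S n \<omega>) \<partial>P)"
      unfolding next_iterate(1)[OF borel_measurable_escape_weight] by (intro nn_integral_mono)
    also have "\<dots> = ennreal \<rho> * (\<integral>\<^sup>+\<omega>. escape_weight \<kappa> (S n \<omega>) \<partial>P)"
      by (rule nn_integral_cmult) measurable
    also have "\<dots> \<le> ennreal \<rho> * ennreal (D * \<rho> ^ n)"
      by (intro mult_left_mono Suc.IH) simp
    also have "\<dots> = ennreal (D * \<rho> ^ Suc n)"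
      using \<rho> \<open>0 < D\<close> by (simp add: mult_ac flip: ennreal_mult)
    finally show ?case .
  qed
  have "measure P {\<omega> \<in> space P. fst (S n \<omega>) \<notin> sublevel F xs r0} \<le> D * \<rho> ^ n" for n
  proof -
    let ?A = "{\<omega> \<in> space P. fst (S n \<omega>) \<notin> sublevel F xs r0}"
    have [measurable]: "?A \<in> sets P"
      unfolding sublevel_def by measurable
    have "ennreal (measure P ?A) = (\<integral>\<^sup>+\<omega>. indicator ?A \<omega> \<partial>P)"
      by (simp add: emeasure_eq_measure)
    also have "\<dots> \<le> (\<integral>\<^sup>+\<omega>. escape_weight \<kappa> (S n \<omega>) \<partial>P)"
    proof (rule nn_integral_mono)
      fix \<omega>
      have "0 \<le> \<kappa> * (F (snd (S n \<omega>)) - F xs)"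
        using \<kappa> minimum by simp
      then have "1 \<le> ennreal (1 + \<kappa> * (F (snd (S n \<omega>)) - F xs))"
        by simp
      then show "indicator ?A \<omega> \<le> escape_weight \<kappa> (S n \<omega>)"
        by (auto simp: escape_weight_def indicator_def)
    qed
    also have "\<dots> \<le> ennreal (D * \<rho> ^ n)"
      by (rule expected)
    finally show ?thesis
      using \<open>0 < D\<close> \<rho> by simp
  qed
  with \<open>0 < D\<close> \<rho> show ?thesis
    unfolding S_def by (rule that)
qed

end

section \<open>Iteration counts and convergence in probability\<close>

text \<open>The bound \<open>\<epsilon> < 1 / 2\<close> keeps \<open>ln (1 / \<epsilon>)\<close> above \<open>ln 2\<close>, so that additive constants can be absorbed
  into the factor.\<close>

lemma obtain_log_iterations:
  fixes \<rho> D :: real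
  assumes "0 < D" "0 < \<rho>" "\<rho> < 1"
  obtains N :: "real \<Rightarrow> nat" and C :: real where "0 \<le> C"
    and "\<And>\<epsilon> n. 0 < \<epsilon> \<Longrightarrow> N \<epsilon> \<le> n \<Longrightarrow> D * \<rho> ^ n < \<epsilon>"
    and "\<And>\<epsilon>. 0 < \<epsilon> \<Longrightarrow> \<epsilon> < 1 / 2 \<Longrightarrow> real (N \<epsilon>) \<le> C * ln (1 / \<epsilon>)"
proof -
  define l where "l = - ln \<rho>"
  have l: "0 < l" using assms by (simp add: l_def)
  define N where "N \<epsilon> = nat \<lceil>ln (D / \<epsilon>) / l\<rceil> + 1" for \<epsilon>
  define C where "C = (\<bar>ln D\<bar> / l + 2) / ln 2 + 1 / l"
  have "0 \<le> C" using l by (simp add: C_def)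
  moreover have "D * \<rho> ^ n < \<epsilon>" if "0 < \<epsilon>" "N \<epsilon> \<le> n" for \<epsilon> n
  proof -
    have "ln (D / \<epsilon>) / l < real (N \<epsilon>)"
      unfolding N_def by linarith
    also have "\<dots> \<le> real n" using that by simp
    finally have "ln (D / \<epsilon>) < real n * l"
      using l by (simp add: pos_divide_less_eq)
    then have "ln D + real n * ln \<rho> < ln \<epsilon>"
      using that assms by (simp add: ln_div l_def)
    moreover have "ln (D * \<rho> ^ n) = ln D + real n * ln \<rho>"
      using assms by (simp add: ln_mult ln_realpow)
    ultimately have "ln (D * \<rho> ^ n) < ln \<epsilon>" by simp
    then show ?thesis
      using assms that by (subst (asm) ln_less_cancel_iff) auto
  qed
  moreover have "real (N \<epsilon>) \<le> C * ln (1 / \<epsilon>)" if "0 < \<epsilon>" "\<epsilon> < 1 / 2" for \<epsilon>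
  proof -
    have "2 \<le> 1 / \<epsilon>" using that by (simp add: field_simps)
    then have ln2: "ln 2 \<le> ln (1 / \<epsilon>)" using that by (intro ln_mono) auto
    have "real (N \<epsilon>) \<le> \<bar>ln (D / \<epsilon>) / l\<bar> + 2"
      unfolding N_def by linarith
    also have "\<bar>ln (D / \<epsilon>) / l\<bar> = \<bar>ln D + ln (1 / \<epsilon>)\<bar> / l"
      using that assms l by (simp add: ln_div)
    also have "\<dots> \<le> (\<bar>ln D\<bar> + ln (1 / \<epsilon>)) / l"
    proof (rule divide_right_mono)
      have "0 \<le> ln (2 :: real)" by simp
      then show "\<bar>ln D + ln (1 / \<epsilon>)\<bar> \<le> \<bar>ln D\<bar> + ln (1 / \<epsilon>)"
        using ln2 by linarith
    qed (use l in simp)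
    also have "\<dots> + 2 = (\<bar>ln D\<bar> / l + 2) * 1 + 1 / l * ln (1 / \<epsilon>)"
      by (simp add: add_divide_distrib)
    also have "\<dots> \<le> (\<bar>ln D\<bar> / l + 2) * (ln (1 / \<epsilon>) / ln 2) + 1 / l * ln (1 / \<epsilon>)"
      using ln2 l by (intro add_right_mono mult_left_mono) auto
    also have "\<dots> = C * ln (1 / \<epsilon>)"
      by (simp add: C_def distrib_right)
    finally show ?thesis by simp
  qed
  ultimately show ?thesis by (rule that)
qed

text \<open>The step bound is at most \<open>\<beta> \<gamma> / (36 L\<^sup>2)\<close>. Since \<open>\<beta> \<gamma> \<le> 36 L\<close>, an admissible step satisfies
  \<open>h L \<le> 1\<close>, which ensures that gradient descent decreases \<open>F\<close>.\<close>

lemma (in lipschitz_gradient) step_bound_imp_step_size: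
  assumes "0 < \<gamma>" "0 < \<beta>" "0 < h" "0 < lam_c" "0 < M_c"
    and "log_sobolev (gibbs F \<gamma>) \<beta>"
    and h: "h < step_bound (measure (gibbs F \<gamma>) S) \<beta> \<gamma> DIM('a) L lam_c M_c"
  shows "0 < measure (gibbs F \<gamma>) S" "h * L \<le> 1" "\<beta> \<le> 36 * L / \<gamma>"
    "measure (gibbs F \<gamma>) S \<le> 1"
proof -
  let ?p = "measure (gibbs F \<gamma>) S" and ?d = "real DIM('a)"
  let ?R = "2 * R_V \<gamma> DIM('a) L lam_c M_c" and ?Q = "6 * sqrt ?d * L / sqrt (\<beta> * \<gamma>)"
  show mass: "0 < ?p"
    using h assms(3) by (cases "?p = 0") (auto simp: step_bound_def zero_less_measure_iff)
  interpret G: prob_space "gibbs F \<gamma>"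
    by (rule gibbs_normalized(3)[OF mass])
  show "?p \<le> 1" by (rule G.prob_le_1)
  have LSI: "\<beta> * \<gamma> \<le> 36 * L"
    by (rule log_sobolev_constant_le[OF assms(1,2,6) mass])
  then show "\<beta> \<le> 36 * L / \<gamma>"
    using assms(1) by (simp add: pos_le_divide_eq)
  have "0 \<le> ?R"
    using assms L_pos by (simp add: R_V_def)
  have "1 \<le> ?d"
    by (simp add: Suc_le_eq)
  have Q: "6 * L / sqrt (\<beta> * \<gamma>) \<le> ?Q"
    using assms L_pos \<open>1 \<le> ?d\<close> by (intro divide_right_mono) auto
  have "0 < 6 * L / sqrt (\<beta> * \<gamma>)"
    using assms L_pos by simp
  then have "?p / (?R + ?Q) \<le> 1 / (6 * L / sqrt (\<beta> * \<gamma>))"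
    using Q \<open>0 \<le> ?R\<close> G.prob_le_1[of S] by (intro frac_le) auto
  then have "(?p / (?R + ?Q))\<^sup>2 \<le> (1 / (6 * L / sqrt (\<beta> * \<gamma>)))\<^sup>2"
    using \<open>0 \<le> ?R\<close> Q \<open>0 < 6 * L / sqrt (\<beta> * \<gamma>)\<close> by (intro power_mono) auto
  also have "\<dots> = \<beta> * \<gamma> / (36 * L\<^sup>2)"
    using assms by (simp add: power_divide power_mult_distrib)
  also have "\<dots> \<le> 36 * L / (36 * L\<^sup>2)"
    using LSI by (intro divide_right_mono) auto
  also have "\<dots> = 1 / L"
    by (simp add: power2_eq_square)
  finally have "h \<le> 1 / L"
    using h by (simp add: step_bound_def)
  then show "h * L \<le> 1"
    using L_pos by (simp add: pos_le_divide_eq)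
qed

theorem theorem2p3:
  fixes F :: "real ^ 'd \<Rightarrow> real"
    and xstar X0 Y0 :: "real ^ 'd"
    and L lam_c M_c r0 \<gamma> h t0 :: real
    and alg :: variant
    and P :: "'w measure"
    and Z :: "nat \<Rightarrow> 'w \<Rightarrow> real ^ 'd"
  defines "p \<equiv> measure (gibbs F \<gamma>) (sublevel F xstar r0)"
    and "X \<equiv> \<lambda>n \<omega>. fst (iterates alg F \<gamma> h t0 X0 Y0 (\<lambda>k. Z k \<omega>) n)"
  assumes "\<forall>x. F differentiable (at x)"
    and "smooth_gradient F L"
    and "coercive F lam_c M_c"
    and "locally_strongly_convex F xstar r0"
    and "0 < \<gamma>"
    and "0 \<le> t0" and "t0 < r0 / 8"
    and "alg = GDxLD \<longrightarrow> 0 < t0"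
    and "0 < h" and "h < 1"
    and "prob_space P" and "iid_std_gaussian P Z"
  shows "\<exists>N :: real \<Rightarrow> real \<Rightarrow> real \<Rightarrow> nat. \<exists>C :: real.
    \<forall>\<beta>>0. log_sobolev (gibbs F \<gamma>) \<beta> \<and> h < step_bound p \<beta> \<gamma> CARD('d) L lam_c M_c \<longrightarrow>
      (\<forall>\<epsilon>>0. \<forall>\<delta>>0. \<forall>n\<ge>N \<beta> \<epsilon> \<delta>.
         measure P {\<omega> \<in> space P. norm (X n \<omega> - xstar) \<le> \<epsilon>} > 1 - \<delta>) \<and>
      (\<forall>\<epsilon>\<in>{0<..<1/2}. \<forall>\<delta>\<in>{0<..<1/2}.
         real (N \<beta> \<epsilon> \<delta>) \<le> C * (K_blocks p \<delta> * n_block \<beta> \<gamma> h) + C * ln (1 / \<epsilon>) \<and>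
         real (N \<beta> \<epsilon> \<delta>) \<le> C * (ln (1 / \<delta>) / \<beta>) + C * ln (1 / \<epsilon>))"
proof -
  interpret strongly_convex_minimum F L xstar r0
    using assms(3,4,6) by unfold_locales auto
  interpret prob_space P by fact
  let ?admissible = "\<lambda>\<beta>. 0 < \<beta> \<and> log_sobolev (gibbs F \<gamma>) \<beta> \<and> h < step_bound p \<beta> \<gamma> CARD('d) L lam_c M_c"
  show ?thesis
  proof (cases "\<exists>\<beta>. ?admissible \<beta>")
    case False
    then show ?thesis by blast
  next
    case True
    have "0 < lam_c" "0 < M_c"
      using assms(5) by (auto simp: coercive_def)
    have admissible: "0 < p" "h * L \<le> 1" "\<beta> \<le> 36 * L / \<gamma>" "p \<le> 1" if "?admissible \<beta>" for \<beta>
      using step_bound_imp_step_size[of \<gamma> \<beta> h lam_c M_c "sublevel F xstar r0"] that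
        assms(7,11) \<open>0 < lam_c\<close> \<open>0 < M_c\<close> unfolding p_def by auto
    have hL: "h * L \<le> 1" and p: "0 < p" "p \<le> 1"
      using True admissible by blast+
    have "t0 < 3 * r0 / 4"
      using assms(9) r0_pos by linarith
    obtain D\<^sub>1 \<rho>\<^sub>1 where D\<^sub>1: "0 < D\<^sub>1" "0 < \<rho>\<^sub>1" "\<rho>\<^sub>1 < 1"
      and escape: "\<And>n. measure P {\<omega> \<in> space P. X n \<omega> \<notin> sublevel F xstar r0} \<le> D\<^sub>1 * \<rho>\<^sub>1 ^ n"
      unfolding X_def
      using obtain_geometric_escape[OF assms(11) hL assms(7,8) \<open>t0 < 3 * r0 / 4\<close> assms(5,13,14)] by blast
    obtain D\<^sub>2 \<rho>\<^sub>2 where D\<^sub>2: "0 < D\<^sub>2" "0 < \<rho>\<^sub>2" "\<rho>\<^sub>2 < 1"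
      and converge: "\<And>\<omega> n k. X n \<omega> \<in> sublevel F xstar r0 \<Longrightarrow> norm (X (n + k) \<omega> - xstar) \<le> D\<^sub>2 * \<rho>\<^sub>2 ^ k"
      unfolding X_def using obtain_convergence_after_entry[OF assms(11) hL assms(8)] by metis
    obtain N\<^sub>1 C\<^sub>1 where C\<^sub>1: "0 \<le> C\<^sub>1" and N\<^sub>1: "\<And>\<delta> n. 0 < \<delta> \<Longrightarrow> N\<^sub>1 \<delta> \<le> n \<Longrightarrow> D\<^sub>1 * \<rho>\<^sub>1 ^ n < \<delta>"
        "\<And>\<delta>. 0 < \<delta> \<Longrightarrow> \<delta> < 1 / 2 \<Longrightarrow> real (N\<^sub>1 \<delta>) \<le> C\<^sub>1 * ln (1 / \<delta>)"
      using obtain_log_iterations[OF D\<^sub>1] by metis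
    obtain N\<^sub>2 C\<^sub>2 where C\<^sub>2: "0 \<le> C\<^sub>2" and N\<^sub>2: "\<And>\<epsilon> n. 0 < \<epsilon> \<Longrightarrow> N\<^sub>2 \<epsilon> \<le> n \<Longrightarrow> D\<^sub>2 * \<rho>\<^sub>2 ^ n < \<epsilon>"
        "\<And>\<epsilon>. 0 < \<epsilon> \<Longrightarrow> \<epsilon> < 1 / 2 \<Longrightarrow> real (N\<^sub>2 \<epsilon>) \<le> C\<^sub>2 * ln (1 / \<epsilon>)"
      using obtain_log_iterations[OF D\<^sub>2] by metis
    have X_meas: "{\<omega> \<in> space P. norm (X n \<omega> - xstar) \<le> \<epsilon>} \<in> events"
        "{\<omega> \<in> space P. X n \<omega> \<notin> sublevel F xstar r0} \<in> events" for n \<epsilon>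
    proof -
      have "X n \<in> borel_measurable P"
        unfolding X_def
        using measurable_compose[OF nn_integral_next_iterate(2)[OF assms(13,14) borel_measurable_const] measurable_fst] .
      note [measurable] = this
      show "{\<omega> \<in> space P. norm (X n \<omega> - xstar) \<le> \<epsilon>} \<in> events"
        by measurable
      show "{\<omega> \<in> space P. X n \<omega> \<notin> sublevel F xstar r0} \<in> events"
        unfolding sublevel_def by measurable
    qed
    have success: "1 - \<delta> < measure P {\<omega> \<in> space P. norm (X n \<omega> - xstar) \<le> \<epsilon>}"
      if "0 < \<epsilon>" "0 < \<delta>" "N\<^sub>1 \<delta> + N\<^sub>2 \<epsilon> \<le> n" for \<epsilon> \<delta> n
    proof -
      let ?bad = "{\<omega> \<in> space P. X (N\<^sub>1 \<delta>) \<omega> \<notin> sublevel F xstar r0}"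
      have n: "N\<^sub>1 \<delta> + (n - N\<^sub>1 \<delta>) = n" "N\<^sub>2 \<epsilon> \<le> n - N\<^sub>1 \<delta>"
        using that(3) by auto
      have "space P - ?bad \<subseteq> {\<omega> \<in> space P. norm (X n \<omega> - xstar) \<le> \<epsilon>}"
        using converge[of "N\<^sub>1 \<delta>" _ "n - N\<^sub>1 \<delta>"] N\<^sub>2(1)[OF that(1) n(2)] unfolding n(1) by force
      then have "prob (space P - ?bad) \<le> prob {\<omega> \<in> space P. norm (X n \<omega> - xstar) \<le> \<epsilon>}"
        by (rule finite_measure_mono) (rule X_meas)
      moreover have "prob (space P - ?bad) = 1 - prob ?bad"
        by (rule prob_compl) (rule X_meas)
      moreover have "prob ?bad < \<delta>"
        using escape[of "N\<^sub>1 \<delta>"] N\<^sub>1(1)[OF that(2) order_refl] by linarith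
      ultimately show ?thesis by linarith
    qed
    \<comment> \<open>An admissible \<open>\<beta>\<close> is at most \<open>B\<close>, so that a bound by \<open>ln (1 / \<delta>)\<close> is also one by \<open>ln (1 / \<delta>) / \<beta>\<close>.\<close>
    define B where "B = 36 * L / \<gamma>"
    have "0 < B" using L_pos assms(7) by (simp add: B_def)
    \<comment> \<open>\<open>c\<close> is the factor, free of \<open>\<beta>\<close> and \<open>\<delta>\<close>, between the two forms of the bound in the claim.\<close>
    define c where "c = ln (1 / h) / (\<gamma> * h * - ln (1 - p / 2))"
    have ln_p: "0 < - ln (1 - p / 2)"
      using p by simp
    have "0 < ln (1 / h)"
      using assms(11,12) by simp
    then have "0 < c"
      using ln_p assms(7,11) unfolding c_def by (intro divide_pos_pos mult_pos_pos)
    have blocks: "K_blocks p \<delta> * n_block \<beta> \<gamma> h = c * (ln (1 / \<delta>) / \<beta>)" if "0 < \<delta>" for \<beta> \<delta>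
      using that by (simp add: K_blocks_def n_block_def c_def ln_div mult_ac)
    define C where "C = C\<^sub>1 * B + C\<^sub>1 * B / c + C\<^sub>2"
    have C: "C\<^sub>1 * B \<le> C" "C\<^sub>1 * B / c \<le> C" "C\<^sub>2 \<le> C"
      using C\<^sub>1 C\<^sub>2 \<open>0 < B\<close> \<open>0 < c\<close> by (auto simp: C_def)
    have bounds: "real (N\<^sub>1 \<delta> + N\<^sub>2 \<epsilon>) \<le> C * (K_blocks p \<delta> * n_block \<beta> \<gamma> h) + C * ln (1 / \<epsilon>)"
        "real (N\<^sub>1 \<delta> + N\<^sub>2 \<epsilon>) \<le> C * (ln (1 / \<delta>) / \<beta>) + C * ln (1 / \<epsilon>)"
      if "?admissible \<beta>" "\<epsilon> \<in> {0<..<1/2}" "\<delta> \<in> {0<..<1/2}" for \<beta> \<epsilon> \<delta>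
    proof -
      have "0 < \<beta>" "\<beta> \<le> B"
        using that(1) admissible(3) by (auto simp: B_def)
      have nonneg: "0 \<le> ln (1 / \<epsilon>)" "0 \<le> ln (1 / \<delta>)"
        using that(2,3) by auto
      then have u: "0 \<le> ln (1 / \<delta>) / \<beta>"
        using \<open>0 < \<beta>\<close> by simp
      have "ln (1 / \<delta>) = \<beta> * (ln (1 / \<delta>) / \<beta>)"
        using \<open>0 < \<beta>\<close> by simp
      also have "\<dots> \<le> B * (ln (1 / \<delta>) / \<beta>)"
        using \<open>\<beta> \<le> B\<close> u by (rule mult_right_mono)
      finally have "C\<^sub>1 * ln (1 / \<delta>) \<le> C\<^sub>1 * B * (ln (1 / \<delta>) / \<beta>)"
        using C\<^sub>1 by (simp only: mult.assoc mult_left_mono)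
      then have N\<^sub>1_le: "real (N\<^sub>1 \<delta>) \<le> C\<^sub>1 * B * (ln (1 / \<delta>) / \<beta>)"
        using N\<^sub>1(2)[of \<delta>] that(3) by auto
      have "real (N\<^sub>2 \<epsilon>) \<le> C\<^sub>2 * ln (1 / \<epsilon>)"
        using that(2) by (intro N\<^sub>2(2)) auto
      also have "\<dots> \<le> C * ln (1 / \<epsilon>)"
        using C(3) nonneg(1) by (rule mult_right_mono)
      finally have N\<^sub>2_le: "real (N\<^sub>2 \<epsilon>) \<le> C * ln (1 / \<epsilon>)" .
      have "C\<^sub>1 * B * (ln (1 / \<delta>) / \<beta>) \<le> C * (ln (1 / \<delta>) / \<beta>)"
        using C(1) u by (rule mult_right_mono)
      with N\<^sub>1_le N\<^sub>2_le show "real (N\<^sub>1 \<delta> + N\<^sub>2 \<epsilon>) \<le> C * (ln (1 / \<delta>) / \<beta>) + C * ln (1 / \<epsilon>)"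
        by simp
      have "C\<^sub>1 * B * (ln (1 / \<delta>) / \<beta>) = C\<^sub>1 * B / c * (c * (ln (1 / \<delta>) / \<beta>))"
        using \<open>0 < c\<close> by simp
      also have "\<dots> \<le> C * (c * (ln (1 / \<delta>) / \<beta>))"
        using C(2) mult_nonneg_nonneg[OF less_imp_le[OF \<open>0 < c\<close>] u] by (rule mult_right_mono)
      also have "c * (ln (1 / \<delta>) / \<beta>) = K_blocks p \<delta> * n_block \<beta> \<gamma> h"
        using blocks that(3) by simp
      finally show "real (N\<^sub>1 \<delta> + N\<^sub>2 \<epsilon>) \<le> C * (K_blocks p \<delta> * n_block \<beta> \<gamma> h) + C * ln (1 / \<epsilon>)"
        using N\<^sub>1_le N\<^sub>2_le by simp
    qed
    show ?thesis
    proof (intro exI[of _ "\<lambda>\<beta> \<epsilon> \<delta>. N\<^sub>1 \<delta> + N\<^sub>2 \<epsilon>"] exI[of _ C] allI impI conjI ballI)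
      fix \<epsilon> \<delta> :: real and n
      assume "0 < \<epsilon>" "0 < \<delta>" "N\<^sub>1 \<delta> + N\<^sub>2 \<epsilon> \<le> n"
      then show "1 - \<delta> < measure P {\<omega> \<in> space P. norm (X n \<omega> - xstar) \<le> \<epsilon>}"
        by (rule success)
    qed (use bounds in blast)+
  qed
qed

end
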